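(* Let $Q\ge 1$ and let $(X,d,\mu)$ be a proper metric measure space that is locally $Q$-homogeneous and supports a local $Q$-Poincaré inequality. Let $(Y,d_Y)$ be any metric space and let $p>Q$. If $f\colon X\to Y$ is a continuous mapping that has an upper gradient in $L^p_{\mathrm{loc}}(X)$, then for every subset $E\subseteq X$, $$\dim_Y f(E)\le \frac{p\,\dim_X E}{p-Q+\dim_X E}.$$ Moreover, if $\mathcal{H}^Q_X(E)=0$, then $\mathcal{H}^Q_Y(f(E))=0$.
   Context: A metric measure space $(X,d,\mu)$ is a metric space with a Borel measure $\mu$ giving positive and finite measure to every nonempty open set. It is proper if every closed ball is compact. $B(x,r)=\{y:d(x,y)<r\}$. $\mathcal{H}^t_Z$ denotes $t$-dimensional Hausdorff measure in a metric space $Z$, and $\dim_Z A$ the Hausdorff dimension of $A\subseteq Z$ with the restricted metric. $(X,d,\mu)$ is locally $Q$-homogeneous if for every compact $K\subseteq X$ there are $R>0$ and $C\ge1$ such that $\mu(B(x,r_2))/r_2^Q\le C\,\mu(B(x,r_1))/r_1^Q$ whenever $x\in K$ and $0<r_1\le r_2< R$. For a continuous map $f\colon X\to Y$, a Borel function $g\colon X\to[0,\infty]$ is an upper gradient of $f$ if $d_Y(f(\gamma(0)),f(\gamma(1)))\le\int_\gamma g\,ds$ for every rectifiable curve $\gamma\colon[0,1]\to X$. $(X,d,\mu)$ supports a local $p$-Poincaré inequality ($p\ge1$) if for every compact $K\subseteq X$ there are constants $C\ge1$, $\sigma\ge1$, $R>0$ such that for every continuous $u\colon X\to\mathbb{R}$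 and every upper gradient $g$ of $u$, $\frac{1}{\mu(B)}\int_B|u-u_B|\,d\mu\le C\operatorname{diam}B\left(\frac{1}{\mu(\sigma B)}\int_{\sigma B}g^p\,d\mu\right)^{1/p}$ for every open ball $B$ centered in $K$ of radius less than $R$, where $u_B$ is the $\mu$-average of $u$ on $B$ and $\sigma B(x,r)=B(x,\sigma r)$. *)

theory Defs
  imports "HOL-Analysis.Analysis"
begin

text \<open>Contribution of one covering set to the t-dimensional Hausdorff content:
  diam(C)^t, with the conventions that the empty set contributes 0 and,
  for t = 0, every nonempty set contributes 1 (0^0 = 1).\<close>
definition hterm :: "real \<Rightarrow> 'a::metric_space set \<Rightarrow> ennreal" where
  "hterm t C = (if C = {} then 0 else if t = 0 then 1 else ennreal (diameter C powr t))"

definition hausdorff_content :: "real \<Rightarrow> real \<Rightarrow> 'a::metric_space set \<Rightarrow> ennreal" where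
  "hausdorff_content t \<delta> A =
     (INF C \<in> {C :: nat \<Rightarrow> 'a set. A \<subseteq> (\<Union>i. C i) \<and> (\<forall>i. bounded (C i) \<and> diameter (C i) \<le> \<delta>)}.
        (\<Sum>i. hterm t (C i)))"

definition hausdorff_measure :: "real \<Rightarrow> 'a::metric_space set \<Rightarrow> ennreal" where
  "hausdorff_measure t A = (SUP \<delta> \<in> {0<..}. hausdorff_content t \<delta> A)"

definition hausdorff_dim :: "'a::metric_space set \<Rightarrow> ereal" where
  "hausdorff_dim A = Inf {ereal t | t. 0 \<le> t \<and> hausdorff_measure t A = 0}"

definition curve_length :: "(real \<Rightarrow> 'a::metric_space) \<Rightarrow> real \<Rightarrow> real \<Rightarrow> ennreal" where
  "curve_length \<gamma> a b =
     (SUP nt \<in> {(n, t). t 0 = a \<and> t n = b \<and> (\<forall>i<n. t i \<le> t (Suc i))}.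
        (\<Sum>i<fst nt. ennreal (dist (\<gamma> (snd nt i)) (\<gamma> (snd nt (Suc i))))))"

definition rectifiable_curve :: "(real \<Rightarrow> 'a::metric_space) \<Rightarrow> bool" where
  "rectifiable_curve \<gamma> \<longleftrightarrow> continuous_on {0..1} \<gamma> \<and> curve_length \<gamma> 0 1 < \<infinity>"

definition arc_param :: "(real \<Rightarrow> 'a::metric_space) \<Rightarrow> real \<Rightarrow> 'a" where
  "arc_param \<gamma> s = \<gamma> (SOME t. t \<in> {0..1} \<and> curve_length \<gamma> 0 t = ennreal s)"

definition line_integral :: "('a::metric_space \<Rightarrow> ennreal) \<Rightarrow> (real \<Rightarrow> 'a) \<Rightarrow> ennreal" where
  "line_integral g \<gamma> =
     (\<integral>\<^sup>+ s. g (arc_param \<gamma> s) * indicator {0..enn2real (curve_length \<gamma> 0 1)} s \<partial>lborel)"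

definition upper_gradient ::
    "('a::metric_space \<Rightarrow> 'b::metric_space) \<Rightarrow> ('a \<Rightarrow> ennreal) \<Rightarrow> bool" where
  "upper_gradient f g \<longleftrightarrow> g \<in> borel_measurable borel \<and>
     (\<forall>\<gamma>. rectifiable_curve \<gamma> \<longrightarrow>
        ennreal (dist (f (\<gamma> 0)) (f (\<gamma> 1))) \<le> line_integral g \<gamma>)"

text \<open>Real powers of extended nonnegative reals (used only with positive exponent).\<close>
definition enn_powr :: "ennreal \<Rightarrow> real \<Rightarrow> ennreal" where
  "enn_powr x p = (if x = \<infinity> then \<infinity> else ennreal (enn2real x powr p))"

definition metric_measure_space :: "'a::metric_space measure \<Rightarrow> bool" where
  "metric_measure_space M \<longleftrightarrow> sets M = sets borel \<and>
     (\<forall>U. open U \<and> U \<noteq> {} \<longrightarrow> 0 < emeasure M U \<and> emeasure M U < \<infinity>)"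

definition proper_space :: "'a::metric_space itself \<Rightarrow> bool" where
  "proper_space _ \<longleftrightarrow> (\<forall>(x::'a) r. compact (cball x r))"

definition locally_homogeneous :: "real \<Rightarrow> 'a::metric_space measure \<Rightarrow> bool" where
  "locally_homogeneous Q M \<longleftrightarrow>
     (\<forall>K. compact K \<longrightarrow> (\<exists>R>0. \<exists>C\<ge>1. \<forall>x\<in>K. \<forall>r1 r2. 0 < r1 \<and> r1 \<le> r2 \<and> r2 < R \<longrightarrow>
        measure M (ball x r2) / r2 powr Q \<le> C * (measure M (ball x r1) / r1 powr Q)))"

definition local_poincare :: "real \<Rightarrow> 'a::metric_space measure \<Rightarrow> bool" where
  "local_poincare p M \<longleftrightarrow>
     (\<forall>K. compact K \<longrightarrow> (\<exists>C\<ge>1. \<exists>\<sigma>\<ge>1. \<exists>R>0.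
        \<forall>(u::'a \<Rightarrow> real) g. continuous_on UNIV u \<and> upper_gradient u g \<longrightarrow>
          (\<forall>x\<in>K. \<forall>r. 0 < r \<and> r < R \<longrightarrow>
             (let B = ball x r; uB = (\<integral>y\<in>B. u y \<partial>M) / measure M B in
               (\<integral>\<^sup>+ y\<in>B. ennreal \<bar>u y - uB\<bar> \<partial>M) / emeasure M B
                 \<le> ennreal (C * diameter B) *
                    enn_powr ((\<integral>\<^sup>+ y\<in>ball x (\<sigma> * r). enn_powr (g y) p \<partial>M)
                                / emeasure M (ball x (\<sigma> * r))) (1 / p)))))"

definition Lp_loc :: "real \<Rightarrow> 'a::metric_space measure \<Rightarrow> ('a \<Rightarrow> ennreal) \<Rightarrow> bool" where
  "Lp_loc p M g \<longleftrightarrow> g \<in> borel_measurable M \<and>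
     (\<forall>K. compact K \<longrightarrow> (\<integral>\<^sup>+ x\<in>K. enn_powr (g x) p \<partial>M) < \<infinity>)"

end

theory Submission
  imports Defs
begin

text \<open>
  Applying the Poincare inequality to the functions \<open>dist (f _) z\<close> and telescoping averages over
  shrinking balls gives a Morrey estimate: the diameter of \<open>f(B(x,r))\<close> is at most a constant times
  \<open>r a\<^sup>1\<^sup>/\<^sup>p\<close>, where \<open>a\<close> is the mean over an enlarged ball of \<open>w = g\<^sup>p + 1\<close>.

  Cover a \<open>\<H>\<^sup>t\<close>-null set by balls with \<open>\<Sum> r\<^sub>i\<^sup>t\<close> small and thin them out to disjoint balls \<open>B\<^sub>i\<close> whose
  threefold enlargements still cover. The enlarged balls on which \<open>a\<^sub>i\<close> is computed may overlap
  heavily, but the weak (1,1) estimate for the maximal function of \<open>w\<close> still bounds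
  \<open>\<Sum> \<mu>(B\<^sub>i) a\<^sub>i\<^sup>q\<^sup>/\<^sup>p\<close>, and hence \<open>\<Sum> r\<^sub>i\<^sup>Q a\<^sub>i\<^sup>q\<^sup>/\<^sup>p\<close>, for every \<open>q < p\<close>. Interpolating between
  this sum and \<open>\<Sum> r\<^sub>i\<^sup>t\<close> shows that the image is \<open>\<H>\<^sup>\<alpha>\<close>-null for \<open>\<alpha> = q t / (q - Q + t)\<close>.
  For \<open>t = Q\<close> this exponent is \<open>Q\<close> whatever \<open>q\<close> is; letting \<open>q\<close> tend to \<open>p\<close> and \<open>t\<close> to
  \<open>dim E\<close> gives the dimension bound.
\<close>

section \<open>Hausdorff null sets and a covering lemma\<close>

lemma powr_le_cancel2:
  fixes x y a :: real
  assumes "0 < a" "0 \<le> y" "x powr a \<le> y powr a"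
  shows "x \<le> y"
  using powr_less_mono2[OF assms(1,2), of x] assms(3) by linarith

lemma diameter_le_dist:
  assumes "0 \<le> d" "\<And>x y. x \<in> S \<Longrightarrow> y \<in> S \<Longrightarrow> dist x y \<le> d"
  shows "diameter S \<le> d"
  using assms by (auto simp: diameter_def intro!: cSUP_least)

lemma ennreal_le_suminf:
  fixes f :: "nat \<Rightarrow> ennreal"
  shows "f i \<le> suminf f"
  using sum_le_suminf[of f "{i}"] by simp

text \<open>The mesh bound \<open>\<delta>\<close> disappears for null sets: since
  \<open>t > 0\<close>, a small sum forces every single diameter to be small. Later proofs with a
  positive exponent work with this form.\<close>

lemma hausdorff_measure_eq_0_iff:
  fixes A :: "'a::metric_space set"
  assumes t: "0 < t"
  shows "hausdorff_measure t A = 0 \<longleftrightarrow>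
    (\<forall>\<epsilon>>0. \<exists>C::nat \<Rightarrow> 'a set. A \<subseteq> (\<Union>i. C i) \<and> (\<forall>i. bounded (C i)) \<and>
       (\<Sum>i. ennreal (diameter (C i) powr t)) \<le> ennreal \<epsilon>)" (is "?L \<longleftrightarrow> ?R")
proof
  have h: "hterm t C = ennreal (diameter C powr t)" for C :: "'a set"
    using t by (auto simp: hterm_def)
  {
    assume ?L
    then have 0: "hausdorff_content t 1 A = 0"
      unfolding hausdorff_measure_def
      by (metis (mono_tags, lifting) SUP_upper greaterThan_iff le_zero_eq zero_less_one)
    show ?R
    proof (intro allI impI)
      fix \<epsilon> :: real assume "\<epsilon> > 0"
      then have "hausdorff_content t 1 A < ennreal \<epsilon>" using 0 by simp
      then obtain C where "A \<subseteq> (\<Union>i. C i)" "\<forall>i. bounded (C i)" "(\<Sum>i. hterm t (C i)) < ennreal \<epsilon>"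
        unfolding hausdorff_content_def INF_less_iff by auto
      then show "\<exists>C::nat \<Rightarrow> 'a set. A \<subseteq> (\<Union>i. C i) \<and> (\<forall>i. bounded (C i)) \<and>
          (\<Sum>i. ennreal (diameter (C i) powr t)) \<le> ennreal \<epsilon>"
        by (auto simp: h intro!: exI[of _ C])
    qed
  next
    assume R: ?R
    have "hausdorff_content t \<delta> A = 0" if \<delta>: "\<delta> > 0" for \<delta>
    proof -
      have "hausdorff_content t \<delta> A \<le> ennreal e" if e: "e > 0" for e
      proof -
        \<comment> \<open>Capping the sum at \<open>\<delta> powr t\<close> caps each of its terms,
          hence each diameter at \<open>\<delta>\<close>.\<close>
        define e' where "e' = min e (\<delta> powr t)"
        have e': "0 < e'" using e \<delta> by (simp add: e'_def)
        obtain C :: "nat \<Rightarrow> 'a set" where C: "A \<subseteq> (\<Union>i. C i)" "\<And>i. bounded (C i)"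
          "(\<Sum>i. ennreal (diameter (C i) powr t)) \<le> ennreal e'"
          using R[rule_format, OF e'] by blast
        have "diameter (C i) \<le> \<delta>" for i
        proof -
          have "ennreal (diameter (C i) powr t) \<le> (\<Sum>i. ennreal (diameter (C i) powr t))"
            by (rule ennreal_le_suminf)
          then have "ennreal (diameter (C i) powr t) \<le> ennreal e'" using C(3) by (rule order_trans)
          then have "diameter (C i) powr t \<le> \<delta> powr t"
            using e' by (simp add: e'_def)
          then show ?thesis
            using powr_le_cancel2[OF t, of \<delta>] \<delta> by simp
        qed
        then have "hausdorff_content t \<delta> A \<le> (\<Sum>i. hterm t (C i))"
          unfolding hausdorff_content_def using C by (intro INF_lower) auto
        also have "\<dots> \<le> ennreal e'" using C by (simp add: h)
        also have "\<dots> \<le> ennreal e" by (simp add: e'_def ennreal_leI)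
        finally show ?thesis .
      qed
      then show ?thesis
        using ennreal_le_epsilon[of 0 "hausdorff_content t \<delta> A"] by simp
    qed
    then show ?L unfolding hausdorff_measure_def by (auto intro!: antisym SUP_least)
  }
qed

lemma hausdorff_null_cover:
  fixes A :: "'a::metric_space set"
  assumes "0 < t" "hausdorff_measure t A = 0" "0 < \<epsilon>"
  obtains C :: "nat \<Rightarrow> 'a set" where "A \<subseteq> (\<Union>i. C i)" "\<And>i. bounded (C i)"
    "(\<Sum>i. ennreal (diameter (C i) powr t)) \<le> ennreal \<epsilon>"
  using assms(2)[unfolded hausdorff_measure_eq_0_iff[OF assms(1)], rule_format, OF assms(3)] that
  by blast

lemma hausdorff_null_mono:
  assumes "0 < t" "hausdorff_measure t B = 0" "A \<subseteq> B"
  shows "hausdorff_measure t A = 0"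
proof (unfold hausdorff_measure_eq_0_iff[OF assms(1)], intro allI impI)
  fix e :: real assume "e > 0"
  from hausdorff_null_cover[OF assms(1,2) this] obtain C :: "nat \<Rightarrow> 'a set"
    where "B \<subseteq> (\<Union>i. C i)" "\<And>i. bounded (C i)"
    "(\<Sum>i. ennreal (diameter (C i) powr t)) \<le> ennreal e" by blast
  with assms(3) show "\<exists>C::nat \<Rightarrow> 'a set. A \<subseteq> (\<Union>i. C i) \<and> (\<forall>i. bounded (C i)) \<and>
    (\<Sum>i. ennreal (diameter (C i) powr t)) \<le> ennreal e" by (intro exI[of _ C]) auto
qed

lemma hausdorff_null_UN:
  fixes A :: "nat \<Rightarrow> 'a::metric_space set"
  assumes t: "0 < t" and A: "\<And>n. hausdorff_measure t (A n) = 0"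
  shows "hausdorff_measure t (\<Union>n. A n) = 0"
proof (unfold hausdorff_measure_eq_0_iff[OF t], intro allI impI)
  fix e :: real assume e: "e > 0"
  have "\<exists>C::nat \<Rightarrow> 'a set. A n \<subseteq> (\<Union>i. C i) \<and> (\<forall>i. bounded (C i)) \<and>
       (\<Sum>i. ennreal (diameter (C i) powr t)) \<le> ennreal (e * (1/2)^Suc n)" for n
    using A[of n, unfolded hausdorff_measure_eq_0_iff[OF t]] e by simp
  from choice[OF allI, OF this] have "\<exists>C. \<forall>n. A n \<subseteq> (\<Union>i. C n i) \<and> (\<forall>i. bounded (C n i)) \<and>
       (\<Sum>i. ennreal (diameter (C n i) powr t)) \<le> ennreal (e * (1/2)^Suc n)"
    by simp
  then obtain C :: "nat \<Rightarrow> nat \<Rightarrow> 'a set" where C: "\<And>n. A n \<subseteq> (\<Union>i. C n i)" "\<And>n i. bounded (C n i)"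
    "\<And>n. (\<Sum>i. ennreal (diameter (C n i) powr t)) \<le> ennreal (e * (1/2)^Suc n)"
    by blast
  define D where "D = (\<lambda>k. case_prod C (prod_decode k))"
  have "(\<Sum>k. ennreal (diameter (D k) powr t)) =
      (\<Sum>k. (\<lambda>(n,i). ennreal (diameter (C n i) powr t)) (prod_decode k))"
    by (simp add: D_def case_prod_unfold)
  also have "\<dots> = (\<Sum>n. \<Sum>i. ennreal (diameter (C n i) powr t))"
    by (rule suminf_ennreal_2dimen) simp
  also have "\<dots> \<le> (\<Sum>n. ennreal (e * (1/2)^Suc n))"
    by (intro suminf_le C(3)) auto
  also have "\<dots> = ennreal e"
    using sums_mult[OF power_half_series, of e] e
    by (intro suminf_ennreal_eq) auto
  finally have "(\<Sum>k. ennreal (diameter (D k) powr t)) \<le> ennreal e" .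
  moreover have "(\<Union>n. A n) \<subseteq> (\<Union>k. D k)"
  proof
    fix x assume "x \<in> (\<Union>n. A n)"
    then obtain n i where "x \<in> C n i" using C(1) by blast
    then have "x \<in> D (prod_encode (n,i))" by (simp add: D_def)
    then show "x \<in> (\<Union>k. D k)" by blast
  qed
  moreover have "bounded (D k)" for k using C(2) by (simp add: D_def case_prod_unfold)
  ultimately show "\<exists>C::nat \<Rightarrow> 'a set. (\<Union>n. A n) \<subseteq> (\<Union>i. C i) \<and> (\<forall>i. bounded (C i)) \<and>
       (\<Sum>i. ennreal (diameter (C i) powr t)) \<le> ennreal e" by blast
qed

text \<open>With the convention 0^0 = 1 every nonempty covering set costs 1, so a cover of content
  below 1 consists of empty sets. \<open>hausdorff_dim\<close> admits the exponent 0, which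
  \<open>hausdorff_measure_eq_0_iff\<close> leaves out.\<close>

lemma hausdorff_measure_0_eq_0:
  assumes "hausdorff_measure 0 A = 0"
  shows "A = {}"
proof -
  have "hausdorff_content 0 1 A = 0"
    using assms unfolding hausdorff_measure_def
    by (metis (mono_tags, lifting) SUP_upper greaterThan_iff le_zero_eq zero_less_one)
  then have "hausdorff_content 0 1 A < 1" by simp
  then obtain C where C: "A \<subseteq> (\<Union>i. C i)" "(\<Sum>i. hterm 0 (C i)) < 1"
    unfolding hausdorff_content_def INF_less_iff by auto
  have "C i = {}" for i
  proof (rule ccontr)
    assume "C i \<noteq> {}"
    then have "1 = hterm 0 (C i)" by (simp add: hterm_def)
    also have "\<dots> \<le> (\<Sum>i. hterm 0 (C i))"
      by (rule ennreal_le_suminf)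
    finally show False using C(2) by simp
  qed
  with C(1) show ?thesis by auto
qed

lemma hausdorff_measure_empty: "0 < t \<Longrightarrow> hausdorff_measure t {} = 0"
  by (auto simp: hausdorff_measure_eq_0_iff intro!: exI[of _ "\<lambda>_. {}"])

text \<open>A cover with sum at most 1 has all diameters at most 1, and there a larger exponent
  gives smaller terms. For \<open>s = 0\<close> the set is empty.\<close>

lemma hausdorff_null_mono_exponent:
  fixes A :: "'a::metric_space set"
  assumes s: "0 \<le> s" "s < t" and A: "hausdorff_measure s A = 0"
  shows "hausdorff_measure t A = 0"
proof (cases "s = 0")
  case True
  then show ?thesis using A s hausdorff_measure_0_eq_0 hausdorff_measure_empty by blast
next
  case False
  with s have s0: "0 < s" "0 < t" by auto
  show ?thesis
  proof (unfold hausdorff_measure_eq_0_iff[OF s0(2)], intro allI impI)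
    fix e :: real assume e: "e > 0"
    then have "min e 1 > 0" by simp
    from hausdorff_null_cover[OF s0(1) A this] obtain C :: "nat \<Rightarrow> 'a set"
      where C: "A \<subseteq> (\<Union>i. C i)" "\<And>i. bounded (C i)"
        "(\<Sum>i. ennreal (diameter (C i) powr s)) \<le> ennreal (min e 1)" by blast
    have "ennreal (diameter (C i) powr t) \<le> ennreal (diameter (C i) powr s)" for i
    proof (rule ennreal_leI)
      have "ennreal (diameter (C i) powr s) \<le> (\<Sum>i. ennreal (diameter (C i) powr s))"
        by (rule ennreal_le_suminf)
      also have "\<dots> \<le> ennreal 1" by (rule order_trans[OF C(3)]) (simp add: ennreal_leI del: ennreal_1)
      finally have "diameter (C i) powr s \<le> 1 powr s"
        by (subst (asm) ennreal_le_iff) auto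
      then have "diameter (C i) \<le> 1"
        using powr_le_cancel2[OF s0(1), of 1] by simp
      moreover have "diameter (C i) \<ge> 0" using C(2) diameter_ge_0 by blast
      ultimately show "diameter (C i) powr t \<le> diameter (C i) powr s"
        using s by (intro powr_mono') auto
    qed
    then have "(\<Sum>i. ennreal (diameter (C i) powr t)) \<le> (\<Sum>i. ennreal (diameter (C i) powr s))"
      by (intro suminf_le) auto
    also have "\<dots> \<le> ennreal e" by (rule order_trans[OF C(3)]) (simp add: ennreal_leI)
    finally show "\<exists>C::nat \<Rightarrow> 'a set. A \<subseteq> (\<Union>i. C i) \<and> (\<forall>i. bounded (C i)) \<and>
       (\<Sum>i. ennreal (diameter (C i) powr t)) \<le> ennreal e" using C by blast
  qed
qed

text \<open>The analytic estimates hold for balls centred in a fixed compact set, so arbitrary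
  covering sets are exchanged for balls with centres in \<open>A\<close>.\<close>

lemma hausdorff_null_ball_cover:
  fixes A :: "'a::metric_space set"
  assumes t: "0 < t" and A: "hausdorff_measure t A = 0" "A \<noteq> {}" and \<eta>: "0 < \<eta>"
  obtains x :: "nat \<Rightarrow> 'a" and r where "\<And>i. x i \<in> A" "\<And>i. 0 < r i" "A \<subseteq> (\<Union>i. ball (x i) (r i))"
    "summable (\<lambda>i. r i powr t)" "(\<Sum>i. r i powr t) \<le> \<eta>"
proof -
  from hausdorff_null_cover[OF t A(1) half_gt_zero[OF \<eta>]] obtain C :: "nat \<Rightarrow> 'a set"
    where C: "A \<subseteq> (\<Union>i. C i)" "\<And>i. bounded (C i)"
      "(\<Sum>i. ennreal (diameter (C i) powr t)) \<le> ennreal (\<eta>/2)" by blast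
  define d where "d i = diameter (C i) powr t" for i
  have sd: "summable d"
    by (rule summable_suminf_not_top) (use C(3) in \<open>auto simp: d_def top_unique\<close>)
  have "ennreal (\<Sum>i. d i) = (\<Sum>i. ennreal (d i))"
    by (rule suminf_ennreal2[symmetric]) (use sd in \<open>simp_all add: d_def[abs_def]\<close>)
  also have "\<dots> \<le> ennreal (\<eta>/2)" using C(3) by (simp add: d_def)
  finally have dle: "(\<Sum>i. d i) \<le> \<eta>/2" using \<eta> by simp
  \<comment> \<open>The radius must exceed the diameter strictly: the balls are open, and a covering
    set may be a single point. The geometric extra terms add up to \<open>\<eta>/2\<close>, the half
    that the cover left free.\<close>
  define w where "w i = d i + \<eta>/2 * (1/2)^Suc i" for i
  have w: "w sums ((\<Sum>i. d i) + \<eta>/2 * 1)"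
    unfolding w_def by (intro sums_add summable_sums sd sums_mult power_half_series)
  have d0: "0 \<le> d i" for i by (simp add: d_def)
  have wd: "d i < w i" for i using \<eta> by (simp add: w_def)
  define r where "r i = w i powr (1/t)" for i
  have w0: "w i > 0" for i using d0[of i] wd[of i] by linarith
  have r0: "r i > 0" for i using w0[of i] by (simp add: r_def)
  have rt: "r i powr t = w i" for i using w0[of i] t by (simp add: r_def powr_powr)
  have dr: "diameter (C i) < r i" for i
  proof (rule ccontr)
    assume "\<not> diameter (C i) < r i"
    then have "r i powr t \<le> diameter (C i) powr t" using r0[of i] t by (intro powr_mono2) auto
    then show False using wd[of i] rt[of i] by (simp add: d_def)
  qed
  obtain a where a: "a \<in> A" using A(2) by auto
  \<comment> \<open>A covering set that misses \<open>A\<close> is exchanged for a ball about the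
    dummy centre \<open>a\<close>.\<close>
  define x where "x i = (if C i \<inter> A = {} then a else SOME y. y \<in> C i \<inter> A)" for i
  have x1: "x i \<in> C i \<inter> A" if "C i \<inter> A \<noteq> {}" for i
    using that some_in_eq[of "C i \<inter> A"] by (simp add: x_def)
  have xA: "x i \<in> A" for i using x1[of i] a by (cases "C i \<inter> A = {}") (auto simp: x_def)
  have "A \<subseteq> (\<Union>i. ball (x i) (r i))"
  proof
    fix y assume y: "y \<in> A"
    then obtain i where i: "y \<in> C i" using C(1) by auto
    then have "x i \<in> C i" using x1[of i] y by auto
    then have "dist (x i) y \<le> diameter (C i)" using C(2) i by (intro diameter_bounded_bound)
    then have "y \<in> ball (x i) (r i)" using dr[of i] by simp
    then show "y \<in> (\<Union>i. ball (x i) (r i))" by blast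
  qed
  moreover have "summable (\<lambda>i. r i powr t)" using w by (simp add: rt sums_iff)
  moreover have "(\<Sum>i. r i powr t) \<le> \<eta>" using w dle by (simp add: rt sums_iff)
  ultimately show thesis using that xA r0 by blast
qed

text \<open>Greedy selection in order of decreasing radius. By \<open>fin\<close> every ball has
  only finitely many at least as large, so this order can be recursed on; a rejected ball meets a
  selected one that is no smaller, whence the factor 3.\<close>

lemma vitali_covering_countable:
  fixes x :: "nat \<Rightarrow> 'a::metric_space"
  assumes pos: "\<And>i. i \<in> I \<Longrightarrow> 0 < r i" and fin: "\<And>c. 0 < c \<Longrightarrow> finite {i\<in>I. c \<le> r i}"
  obtains S where "S \<subseteq> I" "disjoint_family_on (\<lambda>i. ball (x i) (r i)) S"
    "\<And>i. i \<in> I \<Longrightarrow> \<exists>j\<in>S. ball (x i) (r i) \<subseteq> ball (x j) (3 * r j)"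
proof -
  \<comment> \<open>\<open>(i,j) \<in> R\<close> means that \<open>i\<close> is examined before
    \<open>j\<close>: larger radius first, ties broken by index.\<close>
  define R where "R = {(i,j). i \<in> I \<and> j \<in> I \<and> (r j < r i \<or> (r i = r j \<and> i < j))}"
  define bef where "bef i = {j. (j,i) \<in> R}" for i
  have finb: "finite (bef i)" for i
  proof (cases "i \<in> I")
    case True
    then show ?thesis
      by (intro finite_subset[OF _ fin[OF pos[OF True]]]) (auto simp: bef_def R_def)
  qed (auto simp: bef_def R_def)
  \<comment> \<open>The number of predecessors is finite and strictly increases along
    \<open>R\<close>, which makes \<open>R\<close> well founded.\<close>
  have "(i, j) \<in> Wellfounded.measure (\<lambda>i. card (bef i))" if ij: "(i,j) \<in> R" for i j
  proof -
    have "bef i \<subset> bef j"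
    proof
      show "bef i \<subseteq> bef j" using ij by (auto simp: bef_def R_def)
      show "bef i \<noteq> bef j" using ij by (auto simp: bef_def R_def set_eq_iff)
    qed
    then show ?thesis using psubset_card_mono[OF finb] by simp
  qed
  then have wf: "wf R" by (intro wf_subset[OF wf_measure[of "\<lambda>i. card (bef i)"]] subrelI)
  define hit where "hit i j \<longleftrightarrow> ball (x i) (r i) \<inter> ball (x j) (r j) \<noteq> {}" for i j
  \<comment> \<open>One step of the greedy rule: an index is kept iff its ball misses every ball
    kept before it.\<close>
  define F where "F = (\<lambda>sel i. i \<in> I \<and> (\<forall>j. (j,i) \<in> R \<and> hit j i \<longrightarrow> \<not> sel j))"
  define sel where "sel = wfrec R F"
  have sel: "sel i \<longleftrightarrow> i \<in> I \<and> (\<forall>j. (j,i) \<in> R \<and> hit j i \<longrightarrow> \<not> sel j)" for i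
  proof -
    have "sel i = F (cut sel R i) i" unfolding sel_def by (rule wfrec[OF wf])
    then show ?thesis by (auto simp: F_def cut_def)
  qed
  define S where "S = {i. sel i}"
  have SI: "S \<subseteq> I" unfolding S_def using sel by blast
  have disj: "disjoint_family_on (\<lambda>i. ball (x i) (r i)) S"
    unfolding disjoint_family_on_def
  proof (intro ballI impI)
    fix i j assume ij: "i \<in> S" "j \<in> S" "i \<noteq> j"
    then have "i \<in> I" "j \<in> I" using SI by auto
    then have "(i,j) \<in> R \<or> (j,i) \<in> R" using ij(3) by (auto simp: R_def)
    then show "ball (x i) (r i) \<inter> ball (x j) (r j) = {}"
      using ij sel[of i] sel[of j] unfolding S_def hit_def by blast
  qed
  have cov: "\<exists>j\<in>S. ball (x i) (r i) \<subseteq> ball (x j) (3 * r j)" if i: "i \<in> I" for i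
  proof (cases "sel i")
    case True
    then show ?thesis using pos[OF i] by (intro bexI[of _ i]) (auto simp: S_def)
  next
    case False
    then obtain j where j: "(j,i) \<in> R" "hit j i" "sel j" using sel i by blast
    then obtain z where z: "dist (x j) z < r j" "dist (x i) z < r i" by (auto simp: hit_def)
    have rr: "r i \<le> r j" using j by (auto simp: R_def)
    have "ball (x i) (r i) \<subseteq> ball (x j) (3 * r j)"
    proof
      fix y assume "y \<in> ball (x i) (r i)"
      then have "dist (x i) y < r i" by simp
      moreover have "dist (x j) y \<le> dist (x j) z + dist (x i) z + dist (x i) y"
        using dist_triangle[of "x j" y z] dist_triangle[of z y "x i"] by (simp add: dist_commute)
      ultimately show "y \<in> ball (x j) (3 * r j)" using z rr by simp
    qed
    then show ?thesis using j by (auto simp: S_def)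
  qed
  show thesis using that[OF SI disj cov] by blast
qed

section \<open>Homogeneous measures\<close>

text \<open>Local homogeneity with its constants frozen for one set \<open>K\<close> and one scale
  \<open>R\<close>, so that the lemmas below share them.\<close>

locale homogeneous_on =
  fixes M :: "'a::metric_space measure" and K :: "'a set" and Q C R :: real
  assumes mms: "metric_measure_space M" and Q: "1 \<le> Q" and C: "1 \<le> C" and R: "0 < R"
    and homogeneous: "\<And>x r1 r2. x \<in> K \<Longrightarrow> 0 < r1 \<Longrightarrow> r1 \<le> r2 \<Longrightarrow> r2 < R \<Longrightarrow>
      measure M (ball x r2) / r2 powr Q \<le> C * (measure M (ball x r1) / r1 powr Q)"
begin

abbreviation m :: "'a \<Rightarrow> real \<Rightarrow> real" where "m x r \<equiv> measure M (ball x r)"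

lemma sets_M [measurable_cong]: "sets M = sets borel"
  using mms by (simp add: metric_measure_space_def)

lemma space_M [simp]: "space M = UNIV"
  using sets_eq_imp_space_eq[OF sets_M] by simp

sublocale finite_measure M
proof
  \<comment> \<open>The whole space is itself a nonempty open set, so its measure is finite.\<close>
  have "emeasure M UNIV < \<infinity>" using mms unfolding metric_measure_space_def by blast
  then show "emeasure M (space M) \<noteq> \<infinity>" by simp
qed

lemma m_pos: "0 < r \<Longrightarrow> 0 < m x r"
proof -
  assume "0 < r"
  then have "ball x r \<noteq> {}" by simp
  then have "0 < emeasure M (ball x r)" using mms unfolding metric_measure_space_def by blast
  then show ?thesis by (simp add: emeasure_eq_measure)
qed

lemma m_mono: "ball x r \<subseteq> ball y s \<Longrightarrow> m x r \<le> m y s"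
  by (rule finite_measure_mono) (auto simp: sets_M)

lemma doubling:
  assumes "x \<in> K" "0 < r" "1 \<le> \<Lambda>" "\<Lambda> * r < R"
  shows "m x (\<Lambda> * r) \<le> C * \<Lambda> powr Q * m x r"
proof -
  have "r \<le> \<Lambda> * r" using assms(2,3) by simp
  then have "m x (\<Lambda> * r) / (\<Lambda> * r) powr Q \<le> C * (m x r / r powr Q)"
    using homogeneous[OF assms(1,2) _ assms(4)] by simp
  moreover have "(\<Lambda> * r) powr Q = \<Lambda> powr Q * r powr Q" "0 < \<Lambda> powr Q" "0 < r powr Q"
    using assms by (auto simp: powr_mult)
  ultimately show ?thesis by (simp add: field_simps)
qed

text \<open>Finitely many balls of radius \<open>R/4\<close> cover \<open>K\<close>, and each ball
  of radius \<open>R/2\<close> centred in \<open>K\<close> contains one of them. Homogeneity carries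
  this lower bound from the scale \<open>R/2\<close> to all smaller ones.\<close>

lemma lower_mass_bound:
  assumes "compact K"
  obtains c where "0 < c" "\<And>x r. x \<in> K \<Longrightarrow> 0 < r \<Longrightarrow> r \<le> R/2 \<Longrightarrow> c * r powr Q \<le> m x r"
proof -
  have "K \<subseteq> (\<Union>x\<in>K. ball x (R/4))" using R by auto
  then obtain D where D: "D \<subseteq> K" "finite D" "K \<subseteq> (\<Union>x\<in>D. ball x (R/4))"
    using compactE_image[OF assms, of K "\<lambda>x. ball x (R/4)"] by auto
  \<comment> \<open>The inserted 1 keeps the minimum meaningful when \<open>D\<close> is
    empty.\<close>
  define b where "b = Min (insert 1 ((\<lambda>y. m y (R/4)) ` D))"
  have b: "0 < b" using D(2) R m_pos by (auto simp: b_def)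
  have bm: "b \<le> m x (R/2)" if x: "x \<in> K" for x
  proof -
    obtain y where y: "y \<in> D" "dist y x < R/4" using D(3) x by auto
    have "ball y (R/4) \<subseteq> ball x (R/2)"
    proof
      fix z assume "z \<in> ball y (R/4)"
      then show "z \<in> ball x (R/2)" using y(2) dist_triangle[of x z y] by (simp add: dist_commute)
    qed
    then have "m y (R/4) \<le> m x (R/2)" by (rule m_mono)
    moreover have "b \<le> m y (R/4)" unfolding b_def using y D(2) by (intro Min_le) auto
    ultimately show ?thesis by simp
  qed
  define c where "c = b / (C * (R/2) powr Q)"
  show thesis
  proof (rule that[of c])
    show "0 < c" using b C R by (simp add: c_def)
    fix x r assume x: "x \<in> K" and r: "0 < r" "r \<le> R/2"
    have "m x (R/2) / (R/2) powr Q \<le> C * (m x r / r powr Q)"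
      using homogeneous[OF x r] R by simp
    moreover have "b / (R/2) powr Q \<le> m x (R/2) / (R/2) powr Q"
      using bm[OF x] by (intro divide_right_mono) auto
    ultimately have "b / (R/2) powr Q \<le> C * (m x r / r powr Q)" by simp
    moreover have "0 < r powr Q" "0 < (R/2) powr Q" using r R by auto
    ultimately show "c * r powr Q \<le> m x r" using C by (simp add: c_def field_simps)
  qed
qed

text \<open>The weak type (1,1) estimate for the maximal function of N with respect to M, discretized.\<close>
lemma weak_type_balls:
  fixes x :: "nat \<Rightarrow> 'a"
  assumes N: "finite_measure N" "sets N = sets M" and \<Lambda>: "1 \<le> \<Lambda>" and \<tau>: "0 < \<tau>"
    and G: "finite G" "\<And>i. i \<in> G \<Longrightarrow> x i \<in> K" "\<And>i. i \<in> G \<Longrightarrow> 0 < r i" "\<And>i. i \<in> G \<Longrightarrow> 3 * (\<Lambda> * r i) < R"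
    and disj: "disjoint_family_on (\<lambda>i. ball (x i) (r i)) G"
    and large: "\<And>i. i \<in> G \<Longrightarrow> \<tau> * m (x i) (\<Lambda> * r i) \<le> measure N (ball (x i) (\<Lambda> * r i))"
  shows "(\<Sum>i\<in>G. m (x i) (r i)) \<le> C * 3 powr Q * measure N UNIV / \<tau>"
proof -
  interpret N: finite_measure N by fact
  \<comment> \<open>Disjointness of the balls is lost under enlargement by \<open>\<Lambda>\<close>.
    A second selection, among the enlarged balls, restores it, so that their \<open>N\<close>-masses
    add up to at most \<open>measure N UNIV\<close>.\<close>
  obtain S where S: "S \<subseteq> G" "disjoint_family_on (\<lambda>i. ball (x i) (\<Lambda> * r i)) S"
    "\<And>i. i \<in> G \<Longrightarrow> \<exists>j\<in>S. ball (x i) (\<Lambda> * r i) \<subseteq> ball (x j) (3 * (\<Lambda> * r j))"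
    using vitali_covering_countable[of G "\<lambda>i. \<Lambda> * r i" x] G(1,3) \<Lambda> by auto
  have fS: "finite S" using S(1) G(1) finite_subset by blast
  have "(\<Sum>i\<in>G. m (x i) (r i)) = measure M (\<Union>i\<in>G. ball (x i) (r i))"
    using G(1) disj by (intro finite_measure_finite_Union[symmetric]) (auto simp: sets_M)
  also have "\<dots> \<le> measure M (\<Union>j\<in>S. ball (x j) (3 * (\<Lambda> * r j)))"
  proof (rule finite_measure_mono)
    show "(\<Union>i\<in>G. ball (x i) (r i)) \<subseteq> (\<Union>j\<in>S. ball (x j) (3 * (\<Lambda> * r j)))"
    proof
      fix y assume "y \<in> (\<Union>i\<in>G. ball (x i) (r i))"
      then obtain i where i: "i \<in> G" "y \<in> ball (x i) (r i)" by auto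
      have "r i \<le> \<Lambda> * r i" using G(3)[OF i(1)] \<Lambda> by simp
      then have "y \<in> ball (x i) (\<Lambda> * r i)" using i(2) by simp
      then show "y \<in> (\<Union>j\<in>S. ball (x j) (3 * (\<Lambda> * r j)))" using S(3)[OF i(1)] by blast
    qed
  qed (auto simp: sets_M fS intro!: borel_open)
  also have "\<dots> \<le> (\<Sum>j\<in>S. m (x j) (3 * (\<Lambda> * r j)))"
    using fS by (intro finite_measure_subadditive_finite) (auto simp: sets_M)
  also have "\<dots> \<le> (\<Sum>j\<in>S. C * 3 powr Q / \<tau> * measure N (ball (x j) (\<Lambda> * r j)))"
  proof (rule sum_mono)
    fix j assume "j \<in> S"
    then have j: "j \<in> G" using S by auto
    have "m (x j) (3 * (\<Lambda> * r j)) \<le> C * 3 powr Q * m (x j) (\<Lambda> * r j)"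
      using G(2-4)[OF j] \<Lambda> by (intro doubling) auto
    also have "\<dots> \<le> C * 3 powr Q * (measure N (ball (x j) (\<Lambda> * r j)) / \<tau>)"
      using large[OF j] \<tau> C by (intro mult_left_mono) (auto simp: field_simps)
    finally show "m (x j) (3 * (\<Lambda> * r j)) \<le> C * 3 powr Q / \<tau> * measure N (ball (x j) (\<Lambda> * r j))"
      by simp
  qed
  also have "\<dots> = C * 3 powr Q / \<tau> * measure N (\<Union>j\<in>S. ball (x j) (\<Lambda> * r j))"
    using fS S(2) by (subst N.finite_measure_finite_Union) (auto simp: sets_M N sum_distrib_left)
  also have "\<dots> \<le> C * 3 powr Q / \<tau> * measure N UNIV"
    using C \<tau> fS by (intro mult_left_mono N.finite_measure_mono) (auto simp: N sets_M)
  finally show ?thesis by simp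
qed

end

section \<open>Sums of powers of averages over enlarged balls\<close>

text \<open>A discrete layer-cake bound. If \<open>j\<close> is the highest layer with
  \<open>2 ^ j \<le> a\<close>, then \<open>a < 2 ^ Suc j\<close>, and the term of index
  \<open>j\<close> alone dominates; the summand 1 covers \<open>a < 1\<close>.\<close>

lemma powr_le_dyadic_layers:
  fixes a \<theta> :: real
  assumes "0 \<le> a" "a < 2 ^ J" "0 \<le> \<theta>"
  shows "a powr \<theta> \<le> 1 + (\<Sum>j<J. 2 powr \<theta> * (2 powr \<theta>) ^ j * (if 2 ^ j \<le> a then 1 else 0))"
  using assms(2)
proof (induction J)
  case 0
  then show ?case using assms powr_mono2[of \<theta> a 1] by simp
next
  case (Suc J)
  let ?S = "\<lambda>J. \<Sum>j<J. 2 powr \<theta> * (2 powr \<theta>) ^ j * (if 2 ^ j \<le> a then 1 else 0)"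
  show ?case
  proof (cases "a < 2 ^ J")
    case True
    then show ?thesis using Suc.IH by simp
  next
    case False
    have "a powr \<theta> \<le> (2 ^ Suc J) powr \<theta>" using Suc.prems assms by (intro powr_mono2) auto
    also have "\<dots> = 2 powr \<theta> * (2 powr \<theta>) ^ J"
      by (simp add: powr_mult powr_realpow[symmetric] powr_powr mult.commute)
    also have "\<dots> \<le> 1 + ?S J + \<dots>" by (intro add_increasing add_nonneg_nonneg sum_nonneg) auto
    finally show ?thesis using False by simp
  qed
qed

context homogeneous_on
begin

text \<open>By the weak type estimate, the balls whose average is at least \<open>2 ^ j\<close> have
  total mass at most \<open>D / 2 ^ j\<close>, while their weight is of order
  \<open>2 powr (\<theta> * j)\<close>. The products decay geometrically because
  \<open>\<theta> < 1\<close>. It matters that \<open>L\<close> is fixed before the family of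
  balls.\<close>

lemma averaged_powr_sum_bounded:
  assumes N: "finite_measure N" "sets N = sets M" and \<Lambda>: "1 \<le> \<Lambda>" and \<theta>: "0 \<le> \<theta>" "\<theta> < 1"
  obtains L where "0 \<le> L" "\<And>(x :: nat \<Rightarrow> 'a) r F. finite F \<Longrightarrow> (\<And>i. i \<in> F \<Longrightarrow> x i \<in> K) \<Longrightarrow>
    (\<And>i. i \<in> F \<Longrightarrow> 0 < r i) \<Longrightarrow> (\<And>i. i \<in> F \<Longrightarrow> 3 * (\<Lambda> * r i) < R) \<Longrightarrow>
    disjoint_family_on (\<lambda>i. ball (x i) (r i)) F \<Longrightarrow>
    (\<Sum>i\<in>F. m (x i) (r i) *
      (measure N (ball (x i) (\<Lambda> * r i)) / m (x i) (\<Lambda> * r i)) powr \<theta>) \<le> L"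
proof -
  define D where "D = C * 3 powr Q * measure N UNIV"
  have D: "0 \<le> D" using C by (simp add: D_def)
  define w where "w = 2 powr \<theta> / (2::real)"
  have "2 powr \<theta> < (2::real) powr 1" using \<theta> by (intro powr_less_mono) auto
  then have w: "0 \<le> w" "w < 1" by (auto simp: w_def)
  define L where "L = measure M UNIV + 2 powr \<theta> * D / (1 - w)"
  show thesis
  proof (rule that[of L])
    show "0 \<le> L" using D w by (simp add: L_def)
    fix x :: "nat \<Rightarrow> 'a" and r F
    assume F: "finite F" "\<And>i. i \<in> F \<Longrightarrow> x i \<in> K" "\<And>i. i \<in> F \<Longrightarrow> 0 < r i"
      "\<And>i. i \<in> F \<Longrightarrow> 3 * (\<Lambda> * r i) < R" and disj: "disjoint_family_on (\<lambda>i. ball (x i) (r i)) F"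
    define a where "a i = measure N (ball (x i) (\<Lambda> * r i)) / m (x i) (\<Lambda> * r i)" for i
    have a0: "0 \<le> a i" for i by (simp add: a_def)
    \<comment> \<open>\<open>J\<close> depends on the family but enters only as the length of a
      partial geometric sum, so it leaves no trace in \<open>L\<close>.\<close>
    obtain J where J: "Max (insert 0 (a ` F)) < 2 ^ J"
      using real_arch_pow[of 2 "Max (insert 0 (a ` F))"] by auto
    have aJ: "a i < 2 ^ J" if "i \<in> F" for i
      using le_less_trans[OF Max_ge J] that F(1) by auto
    have weak: "(\<Sum>i\<in>F. m (x i) (r i) * (if 2 ^ j \<le> a i then 1 else 0)) \<le> D / 2 ^ j" for j
    proof -
      define G where "G = {i\<in>F. 2 ^ j \<le> a i}"
      have "(\<Sum>i\<in>F. m (x i) (r i) * (if 2 ^ j \<le> a i then 1 else 0)) = (\<Sum>i\<in>G. m (x i) (r i))"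
        unfolding G_def using F(1) by (subst sum.inter_filter) (auto intro!: sum.cong)
      also have "\<dots> \<le> C * 3 powr Q * measure N UNIV / 2 ^ j"
      proof (rule weak_type_balls[OF N \<Lambda>])
        show "disjoint_family_on (\<lambda>i. ball (x i) (r i)) G"
          using disj by (rule disjoint_family_on_mono[rotated]) (auto simp: G_def)
        fix i assume "i \<in> G"
        then have i: "i \<in> F" "2 ^ j \<le> a i" by (auto simp: G_def)
        have "0 < m (x i) (\<Lambda> * r i)" using F(3)[OF i(1)] \<Lambda> by (intro m_pos) auto
        then show "2 ^ j * m (x i) (\<Lambda> * r i) \<le> measure N (ball (x i) (\<Lambda> * r i))"
          using i(2) by (simp add: a_def field_simps)
      qed (use F in \<open>auto simp: G_def\<close>)
      finally show ?thesis by (simp add: D_def)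
    qed
    have "(\<Sum>i\<in>F. m (x i) (r i) * a i powr \<theta>) \<le> (\<Sum>i\<in>F. m (x i) (r i) *
        (1 + (\<Sum>j<J. 2 powr \<theta> * (2 powr \<theta>) ^ j * (if 2 ^ j \<le> a i then 1 else 0))))"
      using a0 aJ \<theta> by (intro sum_mono mult_left_mono powr_le_dyadic_layers) auto
    also have "\<dots> = (\<Sum>i\<in>F. m (x i) (r i)) + (\<Sum>j<J. 2 powr \<theta> * (2 powr \<theta>) ^ j *
        (\<Sum>i\<in>F. m (x i) (r i) * (if 2 ^ j \<le> a i then 1 else 0)))"
      by (simp add: distrib_left sum.distrib sum_distrib_left sum.swap[of _ F] mult_ac)
    also have "\<dots> \<le> measure M UNIV + (\<Sum>j<J. 2 powr \<theta> * (2 powr \<theta>) ^ j * (D / 2 ^ j))"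
    proof (rule add_mono)
      have "(\<Sum>i\<in>F. m (x i) (r i)) = measure M (\<Union>i\<in>F. ball (x i) (r i))"
        using F(1) disj by (intro finite_measure_finite_Union[symmetric]) (auto simp: sets_M)
      also have "\<dots> \<le> measure M UNIV" by (intro finite_measure_mono) (auto simp: sets_M)
      finally show "(\<Sum>i\<in>F. m (x i) (r i)) \<le> measure M UNIV" .
      show "(\<Sum>j<J. 2 powr \<theta> * (2 powr \<theta>) ^ j *
          (\<Sum>i\<in>F. m (x i) (r i) * (if 2 ^ j \<le> a i then 1 else 0)))
        \<le> (\<Sum>j<J. 2 powr \<theta> * (2 powr \<theta>) ^ j * (D / 2 ^ j))"
        by (intro sum_mono mult_left_mono weak) auto
    qed
    also have "(\<Sum>j<J. 2 powr \<theta> * (2 powr \<theta>) ^ j * (D / 2 ^ j)) = 2 powr \<theta> * D * (\<Sum>j<J. w ^ j)"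
      by (simp add: sum_distrib_left w_def power_divide mult_ac)
    also have "(\<Sum>j<J. w ^ j) \<le> 1 / (1 - w)"
      using w sum_le_suminf[OF summable_geometric, of w "{..<J}"] suminf_geometric[of w] by auto
    finally show "(\<Sum>i\<in>F. m (x i) (r i) *
        (measure N (ball (x i) (\<Lambda> * r i)) / m (x i) (\<Lambda> * r i)) powr \<theta>) \<le> L"
      using D by (simp add: L_def a_def mult_left_mono)
  qed
qed

end

section \<open>The Poincare inequality with the exponent p\<close>

lemma enn_powr_measurable [measurable]: "(\<lambda>x. enn_powr x p) \<in> borel_measurable borel"
  unfolding enn_powr_def by measurable

lemma enn_powr_le_ennreal:
  assumes "x \<le> ennreal c" "0 \<le> c" "0 \<le> e"
  shows "enn_powr x e \<le> ennreal (c powr e)"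
proof -
  have "x \<noteq> \<infinity>" using assms(1) by (auto simp: top_unique)
  moreover have "enn2real x \<le> c" using assms(1,2) by (metis enn2real_leI)
  ultimately show ?thesis
    using assms(3) by (auto simp: enn_powr_def intro!: ennreal_leI powr_mono2)
qed

text \<open>Each case \<open>v \<le> s\<close> and \<open>v > s\<close> is dominated by one summand.
  Integrated with a suitable \<open>s\<close>, this takes the place of Hoelder's inequality in
  passing from \<open>Q\<close>-means to \<open>p\<close>-means, at the cost of a factor 2.\<close>

lemma enn_powr_interpolate:
  assumes "0 < s" "0 \<le> Q" "Q \<le> p"
  shows "enn_powr v Q \<le> ennreal (s powr Q) + ennreal (s powr (Q - p)) * enn_powr v p"
proof (cases v)
  case top
  then show ?thesis using assms by (simp add: enn_powr_def ennreal_mult_top)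
next
  case (real a)
  have "a powr Q \<le> s powr Q + s powr (Q - p) * a powr p"
  proof (cases "a \<le> s")
    case True
    then have "a powr Q \<le> s powr Q" using real assms by (intro powr_mono2) auto
    then show ?thesis by (simp add: add_increasing2)
  next
    case False
    have "a powr Q = a powr (Q - p) * a powr p" by (simp add: powr_add[symmetric])
    also have "\<dots> \<le> s powr (Q - p) * a powr p"
      using False assms by (intro mult_right_mono powr_mono2') auto
    finally show ?thesis by (simp add: add_increasing)
  qed
  then show ?thesis using real
    by (simp add: enn_powr_def ennreal_mult[symmetric] ennreal_plus[symmetric] ennreal_leI del: ennreal_plus)
qed

text \<open>Distance functions are 1-Lipschitz. This makes the real-valued Poincare inequality
  applicable to a map into \<open>Y\<close>, with the same \<open>g\<close> for every
  \<open>z\<close>.\<close>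

lemma upper_gradient_dist:
  assumes "upper_gradient f g"
  shows "upper_gradient (\<lambda>y. dist (f y) z) g"
  unfolding upper_gradient_def
proof (intro conjI allI impI)
  show "g \<in> borel_measurable borel" using assms by (simp add: upper_gradient_def)
  fix \<gamma> :: "real \<Rightarrow> 'a" assume "rectifiable_curve \<gamma>"
  then have "ennreal (dist (f (\<gamma> 0)) (f (\<gamma> 1))) \<le> line_integral g \<gamma>"
    using assms by (simp add: upper_gradient_def)
  moreover have "dist (dist (f (\<gamma> 0)) z) (dist (f (\<gamma> 1)) z) \<le> dist (f (\<gamma> 0)) (f (\<gamma> 1))"
    unfolding dist_real_def using dist_triangle[of "f (\<gamma> 0)" z "f (\<gamma> 1)"]
      dist_triangle[of "f (\<gamma> 1)" z "f (\<gamma> 0)"] by (simp add: dist_commute)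
  ultimately show "ennreal (dist (dist (f (\<gamma> 0)) z) (dist (f (\<gamma> 1)) z)) \<le> line_integral g \<gamma>"
    by (meson ennreal_leI order_trans)
qed

lemma set_integrable_ball_continuous:
  fixes u :: "'a::metric_space \<Rightarrow> real"
  assumes M: "finite_measure M" "sets M = sets borel" and "compact (cball x r)"
    and u: "continuous_on UNIV u"
  shows "set_integrable M (ball x r) u"
proof -
  interpret finite_measure M by fact
  have "bounded (u ` cball x r)"
    using assms(3) u by (intro compact_imp_bounded compact_continuous_image continuous_on_subset[OF u]) auto
  then obtain b where b: "\<And>y. y \<in> cball x r \<Longrightarrow> norm (u y) \<le> b" unfolding bounded_iff by blast
  have [measurable]: "u \<in> borel_measurable M" "ball x r \<in> sets M"
    using u by (auto simp: M borel_measurable_continuous_onI cong: measurable_cong_sets)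
  have "set_integrable M (ball x r) (\<lambda>_. \<bar>b\<bar>)" unfolding set_integrable_def
    by (intro integrable_mult_indicator) auto
  then show ?thesis unfolding set_integrable_def
  proof (rule Bochner_Integration.integrable_bound)
    show "AE y in M. norm (indicat_real (ball x r) y *\<^sub>R u y) \<le> norm (indicat_real (ball x r) y *\<^sub>R \<bar>b\<bar>)"
      using b by (intro AE_I2) (auto simp: indicator_def intro: order_trans[OF _ abs_ge_self])
  qed measurable
qed

text \<open>The powers of \<open>g\<close> are absorbed into one finite measure \<open>N\<close>, so
  that the right-hand side becomes a ratio of masses of balls, the form used by
  \<open>averaged_powr_sum_bounded\<close>. \<open>N\<close> and the constants are obtained before
  \<open>z\<close>.\<close>

lemma poincare_power_mean:
  fixes M :: "'a::metric_space measure" and f :: "'a \<Rightarrow> 'b::metric_space"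
  assumes Q: "1 \<le> Q" "Q < p" and mms: "metric_measure_space M" and proper: "proper_space TYPE('a)"
    and poincare: "local_poincare Q M" and f: "continuous_on UNIV f"
    and g: "upper_gradient f g" "Lp_loc p M g"
  fixes x0 :: 'a and n :: real
  obtains N C \<sigma> R where "finite_measure N" "sets N = sets M" "1 \<le> C" "1 \<le> \<sigma>" "0 < R"
    "\<And>z x r. x \<in> cball x0 n \<Longrightarrow> 0 < r \<Longrightarrow> r < R \<Longrightarrow>
      (LINT y:ball x r|M. \<bar>dist (f y) z - (LINT y:ball x r|M. dist (f y) z) / measure M (ball x r)\<bar>)
      \<le> C * r * measure M (ball x r) *
         (measure N (ball x (\<sigma> * r)) / measure M (ball x (\<sigma> * r))) powr (1 / p)"
proof -
  have sM [measurable_cong]: "sets M = sets borel" using mms by (simp add: metric_measure_space_def)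
  have spM [simp]: "space M = UNIV" using sets_eq_imp_space_eq[OF sM] by simp
  have "emeasure M UNIV < \<infinity>" using mms unfolding metric_measure_space_def by blast
  then interpret finite_measure M by (intro finite_measureI) simp
  have cpt: "compact (cball x r)" for x :: 'a and r using proper by (simp add: proper_space_def)
  have gm [measurable]: "g \<in> borel_measurable M" using g by (simp add: Lp_loc_def)
  have bM [measurable]: "ball x r \<in> sets M" for x r by (simp add: sM)
  \<comment> \<open>The margin 1 keeps balls of radius at most 1 about points of
    \<open>cball x0 n\<close> inside \<open>H\<close>. Compactness of \<open>H\<close> makes the
    truncated density integrable.\<close>
  define H where "H = cball x0 (n + 1)"
  have H [measurable]: "H \<in> sets M" by (simp add: H_def sM)
  \<comment> \<open>the summand 1 keeps all means of w positive, so that s below is never 0\<close>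
  define w where "w x = (enn_powr (g x) p + 1) * indicator H x" for x
  have w [measurable]: "w \<in> borel_measurable M" unfolding w_def by measurable
  define N where "N = density M w"
  have N: "emeasure N A = (\<integral>\<^sup>+ y\<in>A. w y \<partial>M)" if "A \<in> sets M" for A
    unfolding N_def using that by (intro emeasure_density) auto
  have sN: "sets N = sets M" by (simp add: N_def)
  have "emeasure N UNIV = (\<integral>\<^sup>+ y. w y \<partial>M)" by (subst N) (auto simp: sM)
  also have "\<dots> = (\<integral>\<^sup>+ y\<in>H. enn_powr (g y) p \<partial>M) + emeasure M H"
    unfolding w_def by (simp add: distrib_right nn_integral_add)
  also have "\<dots> < \<infinity>"
    using g(2) cpt unfolding Lp_loc_def H_def by (simp add: less_top[symmetric])
  finally have finN: "finite_measure N" by (intro finite_measureI) (simp add: N_def)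
  then interpret N: finite_measure N .
  have ballH: "ball x r \<subseteq> H" if "x \<in> cball x0 n" "r \<le> 1" for x r
  proof
    fix y assume "y \<in> ball x r"
    then show "y \<in> H" using that dist_triangle[of x0 y x] by (simp add: H_def)
  qed
  have Nball: "emeasure N (ball x r) = (\<integral>\<^sup>+ y\<in>ball x r. enn_powr (g y) p \<partial>M) + emeasure M (ball x r)"
    if "x \<in> cball x0 n" "r \<le> 1" for x r
  proof -
    have "emeasure N (ball x r) = (\<integral>\<^sup>+ y\<in>ball x r. (enn_powr (g y) p + 1) \<partial>M)"
      using ballH[OF that] by (subst N) (auto simp: sM w_def indicator_def intro!: nn_integral_cong)
    also have "\<dots> = (\<integral>\<^sup>+ y. enn_powr (g y) p * indicator (ball x r) y + indicator (ball x r) y \<partial>M)"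
      by (simp add: distrib_right)
    also have "\<dots> = (\<integral>\<^sup>+ y\<in>ball x r. enn_powr (g y) p \<partial>M) + emeasure M (ball x r)"
      by (subst nn_integral_add) auto
    finally show ?thesis .
  qed
  have MN: "measure M (ball x r) \<le> measure N (ball x r)" if "x \<in> cball x0 n" "r \<le> 1" for x r
  proof -
    have "emeasure M (ball x r) \<le> emeasure N (ball x r)"
      unfolding Nball[OF that] by (simp add: add_increasing)
    then show ?thesis by (simp add: emeasure_eq_measure N.emeasure_eq_measure)
  qed
  have mpos: "0 < measure M (ball x r)" if "0 < r" for x r
  proof -
    have "ball x r \<noteq> {}" using that by simp
    then have "0 < emeasure M (ball x r)" using mms unfolding metric_measure_space_def by blast
    then show ?thesis by (simp add: emeasure_eq_measure)
  qed
  from poincare[unfolded local_poincare_def, rule_format, OF cpt[of x0 n]]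
  obtain C \<sigma> R where C: "1 \<le> C" and \<sigma>: "1 \<le> \<sigma>" and R: "0 < R" and
    P: "\<And>(u::'a \<Rightarrow> real) g x r. continuous_on UNIV u \<Longrightarrow> upper_gradient u g \<Longrightarrow> x \<in> cball x0 n \<Longrightarrow> 0 < r \<Longrightarrow> r < R \<Longrightarrow>
       (\<integral>\<^sup>+ y\<in>ball x r. ennreal \<bar>u y - (\<integral>y\<in>ball x r. u y \<partial>M) / measure M (ball x r)\<bar> \<partial>M) / emeasure M (ball x r)
         \<le> ennreal (C * diameter (ball x r)) *
            enn_powr ((\<integral>\<^sup>+ y\<in>ball x (\<sigma> * r). enn_powr (g y) Q \<partial>M)
                        / emeasure M (ball x (\<sigma> * r))) (1 / Q)"
    by (auto simp: Let_def)
  \<comment> \<open>The bound \<open>1/\<sigma>\<close> keeps \<open>\<sigma> * r\<close> at most 1,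
    so that the enlarged ball stays in \<open>H\<close>.\<close>
  define R' where "R' = min R (1/\<sigma>)"
  show thesis
  proof (rule that[of N "4 * C" \<sigma> R'])
    show "finite_measure N" "sets N = sets M" "1 \<le> 4 * C" "1 \<le> \<sigma>" "0 < R'"
      using finN sN C \<sigma> R by (auto simp: R'_def)
    have "\<sigma> * R' \<le> \<sigma> * (1/\<sigma>)" unfolding R'_def using \<sigma> by (intro mult_left_mono) auto
    then have \<sigma>R: "\<sigma> * R' \<le> 1" using \<sigma> by simp
    fix z x r assume x: "x \<in> cball x0 n" and r: "0 < r" "r < R'"
    define u where "u y = dist (f y) z" for y
    have u: "continuous_on UNIV u" unfolding u_def using f by (intro continuous_intros)
    have ug: "upper_gradient u g" unfolding u_def by (rule upper_gradient_dist[OF g(1)])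
    define B where "B = ball x r"
    define B' where "B' = ball x (\<sigma> * r)"
    have [measurable]: "B \<in> sets M" "B' \<in> sets M" by (auto simp: B_def B'_def sM)
    have \<sigma>r: "0 < \<sigma> * r" using \<sigma> r by simp
    have "\<sigma> * r \<le> \<sigma> * R'" using \<sigma> r by (intro mult_left_mono) auto
    then have \<sigma>r1: "\<sigma> * r \<le> 1" using \<sigma>R by simp
    define b where "b = measure M B"
    define b' where "b' = measure M B'"
    define c where "c = (LINT y:B|M. u y) / b"
    have b: "0 < b" using mpos[OF r(1)] by (simp add: b_def B_def)
    have b': "0 < b'" using mpos[OF \<sigma>r] by (simp add: b'_def B'_def)
    \<comment> \<open>This level balances the two terms of \<open>enn_powr_interpolate\<close> after
      integration over \<open>B'\<close>: both are then bounded by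
      \<open>s powr Q * b'\<close>.\<close>
    define s where "s = (measure N B' / b') powr (1/p)"
    have NB': "b' \<le> measure N B'" unfolding b'_def B'_def using x \<sigma>r1 by (intro MN) auto
    then have s: "0 < s" using b' by (simp add: s_def)
    have sp: "s powr p = measure N B' / b'" using Q b' NB' by (simp add: s_def powr_powr)
    have "(\<integral>\<^sup>+ y\<in>B'. enn_powr (g y) Q \<partial>M)
        \<le> (\<integral>\<^sup>+ y\<in>B'. (ennreal (s powr Q) + ennreal (s powr (Q - p)) * enn_powr (g y) p) \<partial>M)"
      using s Q by (intro nn_integral_mono mult_right_mono enn_powr_interpolate) auto
    also have "\<dots> = (\<integral>\<^sup>+ y. ennreal (s powr Q) * indicator B' y
        + ennreal (s powr (Q - p)) * (enn_powr (g y) p * indicator B' y) \<partial>M)"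
      by (simp add: distrib_left mult_ac)
    also have "\<dots> = ennreal (s powr Q) * emeasure M B' +
        ennreal (s powr (Q - p)) * (\<integral>\<^sup>+ y\<in>B'. enn_powr (g y) p \<partial>M)"
      by (subst nn_integral_add) (auto simp: nn_integral_cmult nn_integral_cmult_indicator)
    also have "\<dots> \<le> ennreal (s powr Q) * emeasure M B' + ennreal (s powr (Q - p)) * emeasure N B'"
      using Nball[OF x \<sigma>r1] by (intro add_left_mono mult_left_mono) (auto simp: B'_def)
    also have "\<dots> = ennreal (s powr Q * b' + s powr (Q - p) * measure N B')"
      using b' by (simp add: emeasure_eq_measure N.emeasure_eq_measure b'_def ennreal_mult)
    also have "s powr Q * b' + s powr (Q - p) * measure N B' = 2 * s powr Q * b'"
    proof -
      have "measure N B' = s powr p * b'" using sp b' by simp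
      then have "s powr (Q - p) * measure N B' = s powr Q * b'"
        by (simp add: powr_add[symmetric] mult.assoc[symmetric])
      then show ?thesis by simp
    qed
    finally have "(\<integral>\<^sup>+ y\<in>B'. enn_powr (g y) Q \<partial>M) / emeasure M B' \<le> ennreal (2 * s powr Q * b') / ennreal b'"
      by (simp add: divide_right_mono_ennreal emeasure_eq_measure b'_def)
    also have "\<dots> = ennreal (2 * s powr Q)" using b' by (simp add: divide_ennreal)
    finally have "enn_powr ((\<integral>\<^sup>+ y\<in>B'. enn_powr (g y) Q \<partial>M) / emeasure M B') (1/Q)
        \<le> ennreal ((2 * s powr Q) powr (1/Q))"
      using Q by (intro enn_powr_le_ennreal) auto
    also have "(2 * s powr Q) powr (1/Q) \<le> 2 * s"
    proof -
      have "(2 * s powr Q) powr (1/Q) = 2 powr (1/Q) * s" using s Q by (simp add: powr_mult powr_powr)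
      also have "\<dots> \<le> 2 powr 1 * s" using s Q by (intro mult_right_mono powr_mono) auto
      finally show ?thesis by simp
    qed
    finally have E: "enn_powr ((\<integral>\<^sup>+ y\<in>B'. enn_powr (g y) Q \<partial>M) / emeasure M B') (1/Q) \<le> ennreal (2 * s)"
      by (simp add: ennreal_leI)
    have cB: "set_integrable M B (\<lambda>y. \<bar>u y - c\<bar>)" unfolding B_def
      by (rule set_integrable_ball_continuous[OF finite_measure_axioms sM cpt])
        (intro continuous_intros u)
    have nn: "(\<integral>\<^sup>+ y\<in>B. ennreal \<bar>u y - c\<bar> \<partial>M) = ennreal (LINT y:B|M. \<bar>u y - c\<bar>)"
      unfolding set_lebesgue_integral_def using cB[unfolded set_integrable_def]
      by (subst nn_integral_eq_integral[symmetric])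
        (auto simp: indicator_def intro!: nn_integral_cong split: if_splits)
    have "ennreal ((LINT y:B|M. \<bar>u y - c\<bar>) / b) = (\<integral>\<^sup>+ y\<in>B. ennreal \<bar>u y - c\<bar> \<partial>M) / emeasure M B"
      unfolding nn using b by (subst divide_ennreal[symmetric])
        (auto simp: emeasure_eq_measure b_def set_lebesgue_integral_def)
    also have "\<dots> \<le> ennreal (C * diameter B) * enn_powr ((\<integral>\<^sup>+ y\<in>B'. enn_powr (g y) Q \<partial>M) / emeasure M B') (1/Q)"
      using P[OF u ug x r(1)] r(2) unfolding B_def B'_def c_def b_def R'_def by simp
    \<comment> \<open>The final factor 4 arises here: one 2 from the diameter of the ball, the other
      from the interpolation.\<close>
    also have "\<dots> \<le> ennreal (C * (2 * r)) * ennreal (2 * s)"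
    proof (intro mult_mono E ennreal_leI mult_left_mono)
      show "diameter B \<le> 2 * r" unfolding B_def
      proof (rule diameter_le_dist)
        fix y y' assume "y \<in> ball x r" "y' \<in> ball x r"
        then show "dist y y' \<le> 2 * r" using dist_triangle[of y y' x] by (simp add: dist_commute)
      qed (use r in auto)
    qed (use C in \<open>auto simp: B_def intro: diameter_ge_0\<close>)
    also have "\<dots> = ennreal (4 * C * r * s)" using C r s by (simp add: ennreal_mult[symmetric] mult_ac)
    finally have "(LINT y:B|M. \<bar>u y - c\<bar>) / b \<le> 4 * C * r * s"
      using C r s by (subst (asm) ennreal_le_iff) auto
    then have "(LINT y:B|M. \<bar>u y - c\<bar>) \<le> 4 * C * r * b * s" using b by (simp add: field_simps)
    then show "(LINT y:ball x r|M. \<bar>dist (f y) z - (LINT y:ball x r|M. dist (f y) z) / measure M (ball x r)\<bar>)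
      \<le> 4 * C * r * measure M (ball x r) *
         (measure N (ball x (\<sigma> * r)) / measure M (ball x (\<sigma> * r))) powr (1 / p)"
      by (simp add: c_def b_def b'_def B_def B'_def u_def s_def)
  qed
qed

section \<open>The Morrey estimate\<close>

lemma telescoping_geometric_bound:
  fixes a :: "nat \<Rightarrow> real"
  assumes step: "\<And>j. \<bar>a (Suc j) - a j\<bar> \<le> c * w ^ j" and lim: "a \<longlonglongrightarrow> l"
    and w: "0 \<le> w" "w < 1" and c: "0 \<le> c"
  shows "\<bar>l - a 0\<bar> \<le> c / (1 - w)"
proof -
  have "\<bar>a j - a 0\<bar> \<le> c * (\<Sum>i<j. w ^ i)" for j
  proof (induction j)
    case (Suc j)
    have "\<bar>a (Suc j) - a 0\<bar> \<le> \<bar>a (Suc j) - a j\<bar> + \<bar>a j - a 0\<bar>" by simp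
    then show ?case using Suc step[of j] by (simp add: distrib_left)
  qed simp
  moreover have "(\<Sum>i<j. w ^ i) \<le> 1 / (1 - w)" for j
    using w sum_le_suminf[OF summable_geometric, of w "{..<j}"] suminf_geometric[of w] by auto
  ultimately have "\<bar>a j - a 0\<bar> \<le> c * (1 / (1 - w))" for j
    using c by (meson mult_left_mono order_trans)
  moreover have "(\<lambda>j. \<bar>a j - a 0\<bar>) \<longlonglongrightarrow> \<bar>l - a 0\<bar>" by (intro tendsto_intros lim)
  ultimately show ?thesis by (intro LIMSEQ_le_const2) auto
qed

text \<open>\<open>u\<close> stands for \<open>dist (f _) z\<close>. The constants derived in this
  locale do not involve \<open>u\<close>, so \<open>z\<close> can later be chosen depending on the
  point.\<close>

locale morrey = homogeneous_on M K Q C R for M :: "'a::metric_space measure" and K Q C R +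
  fixes N :: "'a measure" and u :: "'a \<Rightarrow> real" and p P \<sigma> :: real
  assumes N: "finite_measure N" "sets N = sets M" and Qp: "Q < p" and P: "1 \<le> P" and \<sigma>: "1 \<le> \<sigma>"
    and u: "continuous_on UNIV u" and integrable_u: "\<And>x r. set_integrable M (ball x r) u"
    and poincare: "\<And>x r. x \<in> K \<Longrightarrow> 0 < r \<Longrightarrow> r < R \<Longrightarrow>
      (LINT y:ball x r|M. \<bar>u y - (LINT y:ball x r|M. u y) / m x r\<bar>)
      \<le> P * r * m x r * (measure N (ball x (\<sigma> * r)) / m x (\<sigma> * r)) powr (1 / p)"
begin

definition avg :: "'a \<Rightarrow> real \<Rightarrow> real" where
  "avg x r = (LINT y:ball x r|M. u y) / m x r"

definition mean_density :: "'a \<Rightarrow> real \<Rightarrow> real" where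
  "mean_density x r = (measure N (ball x r) / m x r) powr (1 / p)"

lemma ball_sets [simp]: "ball x r \<in> sets M" by (simp add: sets_M)

lemma ball_integral_const: "(LINT y:ball x r|M. c) = c * m x r"
  by (simp add: set_lebesgue_integral_def mult.commute)

lemma ball_integrable:
  "set_integrable M (ball x r) (\<lambda>y. u y - c)" "set_integrable M (ball x r) (\<lambda>y. \<bar>u y - c\<bar>)"
proof -
  have "set_integrable M (ball x r) (\<lambda>_. c)" unfolding set_integrable_def
    by (intro integrable_mult_indicator) auto
  then show 1: "set_integrable M (ball x r) (\<lambda>y. u y - c)" using integrable_u by (rule set_integral_diff(1)[rotated])
  show "set_integrable M (ball x r) (\<lambda>y. \<bar>u y - c\<bar>)" using set_integrable_abs[OF 1] .
qed

lemma avg_diff_const: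
  assumes "0 < r"
  shows "\<bar>avg x r - c\<bar> \<le> (LINT y:ball x r|M. \<bar>u y - c\<bar>) / m x r"
proof -
  have ci: "set_integrable M (ball x r) (\<lambda>_. c)" unfolding set_integrable_def
    by (intro integrable_mult_indicator) auto
  have "(LINT y:ball x r|M. u y - c) = (LINT y:ball x r|M. u y) - (LINT y:ball x r|M. c)"
    by (rule set_integral_diff(2)[OF integrable_u ci])
  also have "(LINT y:ball x r|M. c) = c * m x r"
    by (rule ball_integral_const)
  finally have "avg x r - c = (LINT y:ball x r|M. u y - c) / m x r"
    using m_pos[OF assms, of x] by (simp add: avg_def field_simps)
  moreover have "\<bar>LINT y:ball x r|M. u y - c\<bar> \<le> (LINT y:ball x r|M. \<bar>u y - c\<bar>)"
    using set_integral_norm_bound[OF ball_integrable(1)[of x r c]] by simp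
  ultimately show ?thesis using m_pos[OF assms, of x] by (simp add: divide_right_mono)
qed

text \<open>The oscillation integral over the small ball is enlarged to the big one, and the change
  of normalisation costs \<open>D\<close>. This serves both for halving a radius and for moving the
  centre.\<close>

lemma avg_diff_avg:
  assumes x: "x \<in> K" and r: "0 < r" "r < R" and s: "0 < s" and sub: "ball y s \<subseteq> ball x r"
    and D: "m x r \<le> D * m y s"
  shows "\<bar>avg y s - avg x r\<bar> \<le> P * D * r * mean_density x (\<sigma> * r)"
proof -
  have "\<bar>avg y s - avg x r\<bar> \<le> (LINT z:ball y s|M. \<bar>u z - avg x r\<bar>) / m y s"
    by (rule avg_diff_const[OF s])
  also have "\<dots> \<le> (LINT z:ball x r|M. \<bar>u z - avg x r\<bar>) / m y s"
  proof (rule divide_right_mono)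
    show "(LINT z:ball y s|M. \<bar>u z - avg x r\<bar>) \<le> (LINT z:ball x r|M. \<bar>u z - avg x r\<bar>)"
      unfolding set_lebesgue_integral_def
      using ball_integrable(2)[unfolded set_integrable_def] sub
      by (intro integral_mono) (auto simp: indicator_def)
  qed simp
  also have "\<dots> \<le> (P * r * m x r * mean_density x (\<sigma> * r)) / m y s"
    using poincare[OF x r] unfolding avg_def mean_density_def by (intro divide_right_mono) auto
  also have "\<dots> = P * r * mean_density x (\<sigma> * r) * (m x r / m y s)" by simp
  also have "\<dots> \<le> P * r * mean_density x (\<sigma> * r) * D"
    using D m_pos[OF s, of y] P r by (intro mult_left_mono) (auto simp: field_simps mean_density_def)
  finally show ?thesis by (simp add: mult_ac)
qed

text \<open>Continuity gives convergence at every point, so no exceptional null set arises as it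
  would with Lebesgue points.\<close>

lemma avg_tendsto:
  assumes "0 < r"
  shows "(\<lambda>j. avg x (r * (1/2) ^ j)) \<longlonglongrightarrow> u x"
proof (rule LIMSEQ_I)
  fix e :: real assume e: "0 < e"
  have "isCont u x" using u by (simp add: continuous_on_eq_continuous_at)
  then obtain d where d: "0 < d" "\<And>y. dist y x < d \<Longrightarrow> dist (u y) (u x) < e/2"
    using e unfolding continuous_at_eps_delta by (meson half_gt_zero)
  have "(\<lambda>j. r * (1/2::real) ^ j) \<longlonglongrightarrow> r * 0" by (intro tendsto_intros LIMSEQ_power_zero) auto
  then obtain j0 where j0: "\<And>j. j0 \<le> j \<Longrightarrow> r * (1/2) ^ j < d"
    using d(1) order_tendstoD(2)[of _ "r * 0" sequentially d] unfolding eventually_sequentially by auto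
  have "norm (avg x (r * (1/2) ^ j) - u x) < e" if j: "j0 \<le> j" for j
  proof -
    define s where "s = r * (1/2) ^ j"
    have s: "0 < s" "s < d" using assms j0[OF j] by (auto simp: s_def)
    have ci: "set_integrable M (ball x s) (\<lambda>_. e/2)" unfolding set_integrable_def
      by (intro integrable_mult_indicator) auto
    have "(LINT y:ball x s|M. \<bar>u y - u x\<bar>) \<le> (LINT y:ball x s|M. e/2)"
    proof (rule set_integral_mono[OF ball_integrable(2) ci])
      fix y assume "y \<in> ball x s"
      then show "\<bar>u y - u x\<bar> \<le> e/2" using d(2)[of y] s by (simp add: dist_commute dist_real_def abs_minus_commute)
    qed
    also have "\<dots> = e/2 * m x s" by (rule ball_integral_const)
    finally have "(LINT y:ball x s|M. \<bar>u y - u x\<bar>) / m x s \<le> e/2"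
      using m_pos[OF s(1), of x] by (simp add: field_simps)
    then show ?thesis using avg_diff_const[OF s(1), of x "u x"] e unfolding s_def real_norm_def by linarith
  qed
  then show "\<exists>no. \<forall>j\<ge>no. norm (avg x (r * (1/2) ^ j) - u x) < e" by blast
qed

lemma mean_density_le:
  assumes sub: "ball y s \<subseteq> ball x r" and "0 < s" "0 < r" and D: "m x r \<le> D * m y s" "0 \<le> D"
  shows "mean_density y s \<le> D powr (1/p) * mean_density x r"
proof -
  interpret N: finite_measure N by (rule N)
  have "measure N (ball y s) \<le> measure N (ball x r)"
    using sub by (intro N.finite_measure_mono) (auto simp: N)
  then have "measure N (ball y s) / m y s \<le> measure N (ball x r) / m y s" 
    by (intro divide_right_mono) auto
  also have "\<dots> \<le> measure N (ball x r) * (D / m x r)"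
    using D m_pos[OF assms(2), of y] m_pos[OF assms(3), of x]
    using mult_right_mono[OF D(1), of "measure N (ball x r)"] by (simp add: field_simps)
  finally have "(measure N (ball y s) / m y s) powr (1/p) \<le> (D * (measure N (ball x r) / m x r)) powr (1/p)"
    using Qp Q by (intro powr_mono2) (auto simp: mult_ac)
  also have "\<dots> = D powr (1/p) * (measure N (ball x r) / m x r) powr (1/p)"
    by (rule powr_mult)
  finally show ?thesis by (simp add: mean_density_def)
qed

text \<open>Ratio of the telescoping series: each halving of the radius contributes 1/2, while the
  bound on the mean density grows by \<open>2 powr (Q/p)\<close>. It is below 1 because
  \<open>Q < p\<close>.\<close>

definition decay :: real where "decay = 2 powr (Q / p) / 2"

text \<open>The summed series of \<open>point_avg_bound\<close>: \<open>P * (C * 2 powr Q)\<close>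
  comes from one jump between consecutive averages, \<open>C powr (1/p)\<close> from comparing mean
  densities at different scales.\<close>

definition C1 :: real where "C1 = P * (C * 2 powr Q) * C powr (1/p) / (1 - decay)"

lemma decay: "0 \<le> decay" "decay < 1"
proof -
  have "2 powr (Q/p) < (2::real) powr 1" using Q Qp by (intro powr_less_mono) auto
  then show "0 \<le> decay" "decay < 1" by (auto simp: decay_def)
qed

lemma C1_nonneg: "0 \<le> C1"
  using P C decay by (simp add: C1_def)

lemma point_avg_bound:
  assumes x: "x \<in> K" and r: "0 < r" "\<sigma> * r < R"
  shows "\<bar>u x - avg x r\<bar> \<le> C1 * r * mean_density x (\<sigma> * r)"
proof -
  define a where "a j = avg x (r * (1/2) ^ j)" for j
  define c where "c = P * (C * 2 powr Q) * r * (C powr (1/p) * mean_density x (\<sigma> * r))"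
  have rR: "r < R" using r \<sigma> mult_right_mono[of 1 \<sigma> r] by linarith
  have "\<bar>a (Suc j) - a j\<bar> \<le> c * decay ^ j" for j
  proof -
    define s where "s = r * (1/2) ^ j"
    have s: "0 < s" "s \<le> r" using r by (auto simp: s_def power_le_one mult_left_le)
    have "m x (2 * (s/2)) \<le> C * 2 powr Q * m x (s/2)"
      using s rR x by (intro doubling) auto
    then have "\<bar>avg x (s/2) - avg x s\<bar> \<le> P * (C * 2 powr Q) * s * mean_density x (\<sigma> * s)"
      using s rR by (intro avg_diff_avg x) auto
    \<comment> \<open>Homogeneity is applied once with ratio \<open>2 ^ j\<close>, not
      \<open>j\<close> times with ratio 2. The constant is then \<open>C\<close> instead of
      \<open>C ^ j\<close>, and the ratio of the series remains \<open>decay\<close>.\<close>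
    also have "mean_density x (\<sigma> * s) \<le> (C * (2 ^ j) powr Q) powr (1/p) * mean_density x (\<sigma> * r)"
    proof (rule mean_density_le)
      show "ball x (\<sigma> * s) \<subseteq> ball x (\<sigma> * r)" using s \<sigma> by (intro subset_ball mult_left_mono) auto
      have "m x (2 ^ j * (\<sigma> * s)) \<le> C * (2 ^ j) powr Q * m x (\<sigma> * s)"
        using s \<sigma> r x by (intro doubling) (auto simp: s_def power_one_over)
      then show "m x (\<sigma> * r) \<le> C * (2 ^ j) powr Q * m x (\<sigma> * s)"
        by (simp add: s_def power_one_over)
    qed (use s r \<sigma> C in auto)
    also have "(C * (2 ^ j) powr Q) powr (1/p) = C powr (1/p) * (2 powr (Q/p)) ^ j"
    proof -
      have "((2::real) ^ j) powr Q = 2 powr (real j * Q)" by (simp add: powr_realpow[symmetric] powr_powr)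
      then have "(C * (2 ^ j) powr Q) powr (1/p) = C powr (1/p) * 2 powr (real j * Q / p)"
        using C by (simp add: powr_mult powr_powr)
      also have "2 powr (real j * Q / p) = (2 powr (Q/p)) powr (real j)" by (simp add: powr_powr mult_ac)
      also have "\<dots> = (2 powr (Q/p)) ^ j" by (simp add: powr_realpow)
      finally show ?thesis .
    qed
    finally have "\<bar>avg x (s/2) - avg x s\<bar> \<le>
      P * (C * 2 powr Q) * s * (C powr (1/p) * (2 powr (Q/p)) ^ j * mean_density x (\<sigma> * r))"
      using P C s by (simp add: mult_left_mono)
    also have "\<dots> = c * decay ^ j"
      by (simp add: c_def s_def decay_def power_divide mult_ac)
    finally show ?thesis by (simp add: a_def s_def mult_ac)
  qed
  moreover have "a \<longlonglongrightarrow> u x" unfolding a_def by (rule avg_tendsto[OF r(1)])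
  moreover have "0 \<le> c" using P C r by (simp add: c_def mean_density_def)
  ultimately have "\<bar>u x - a 0\<bar> \<le> c / (1 - decay)"
    using decay by (intro telescoping_geometric_bound)
  then show ?thesis by (simp add: a_def c_def C1_def mult_ac)
qed

text \<open>The summands belong to the three legs of \<open>morrey_estimate\<close>: from
  \<open>u y\<close> to the average over \<open>ball y \<rho>\<close>, on to the average over
  \<open>ball x (2 * \<rho>)\<close>, and from there to \<open>u x\<close>.\<close>

definition Cm :: real where
  "Cm = C1 * (C * 4 powr Q) powr (1/p) + P * (C * 4 powr Q) * 2 + C1 * 2"

lemma Cm_nonneg: "0 \<le> Cm"
  using C1_nonneg P C by (simp add: Cm_def)

theorem morrey_estimate:
  assumes x: "x \<in> K" and y: "y \<in> K" and xy: "dist x y < \<rho>" and \<rho>: "4 * (\<sigma> * \<rho>) < R"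
  shows "\<bar>u y - u x\<bar> \<le> Cm * \<rho> * mean_density x (2 * (\<sigma> * \<rho>))"
proof -
  have \<rho>0: "0 < \<rho>" using xy zero_le_dist[of x y] by linarith
  then have \<sigma>\<rho>: "\<rho> \<le> \<sigma> * \<rho>" using \<sigma> by simp
  define A where "A = mean_density x (2 * (\<sigma> * \<rho>))"
  have lt: "\<sigma> * \<rho> < R" "4 * \<rho> < R" "2 * \<rho> < R" "\<sigma> * (2 * \<rho>) < R" "0 < \<sigma> * \<rho>" "0 < 2 * \<rho>"
    using \<rho> \<sigma>\<rho> \<rho>0 by linarith+
  \<comment> \<open>Needed for two values: \<open>s = \<rho>\<close> to compare averages and
    \<open>s = \<sigma> * \<rho>\<close> to compare mean densities.\<close>
  have b1: "ball y s \<subseteq> ball x (2 * s)" "ball x (2 * s) \<subseteq> ball y (4 * s)" if "\<rho> \<le> s" for s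
  proof -
    show "ball y s \<subseteq> ball x (2 * s)"
    proof
      fix z assume "z \<in> ball y s"
      then show "z \<in> ball x (2 * s)" using that xy dist_triangle[of x z y] by simp
    qed
    show "ball x (2 * s) \<subseteq> ball y (4 * s)"
    proof
      fix z assume "z \<in> ball x (2 * s)"
      then show "z \<in> ball y (4 * s)" using that \<rho>0 xy dist_triangle[of y z x] by (simp add: dist_commute)
    qed
  qed
  have D: "m x (2 * s) \<le> C * 4 powr Q * m y s" if "\<rho> \<le> s" "4 * s < R" for s
  proof -
    have "m x (2 * s) \<le> m y (4 * s)" using b1(2)[OF that(1)] by (rule m_mono)
    also have "\<dots> \<le> C * 4 powr Q * m y s" using that y \<rho>0 by (intro doubling) auto
    finally show ?thesis .
  qed
  have "\<bar>u y - avg y \<rho>\<bar> \<le> C1 * \<rho> * mean_density y (\<sigma> * \<rho>)"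
    using y \<rho>0 lt by (intro point_avg_bound)
  also have "mean_density y (\<sigma> * \<rho>) \<le> (C * 4 powr Q) powr (1/p) * A" unfolding A_def
    using \<sigma>\<rho> \<rho> lt C by (intro mean_density_le b1 D) auto
  finally have 1: "\<bar>u y - avg y \<rho>\<bar> \<le> C1 * \<rho> * ((C * 4 powr Q) powr (1/p) * A)"
    using C1_nonneg \<rho>0 by (simp add: mult_left_mono)
  have "\<bar>avg y \<rho> - avg x (2 * \<rho>)\<bar> \<le> P * (C * 4 powr Q) * (2 * \<rho>) * mean_density x (\<sigma> * (2 * \<rho>))"
    using \<rho>0 lt by (intro avg_diff_avg x b1 D) auto
  then have 2: "\<bar>avg y \<rho> - avg x (2 * \<rho>)\<bar> \<le> P * (C * 4 powr Q) * (2 * \<rho>) * A"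
    by (simp add: A_def mult_ac)
  have "\<bar>u x - avg x (2 * \<rho>)\<bar> \<le> C1 * (2 * \<rho>) * mean_density x (\<sigma> * (2 * \<rho>))"
    using x lt by (intro point_avg_bound)
  then have 3: "\<bar>u x - avg x (2 * \<rho>)\<bar> \<le> C1 * (2 * \<rho>) * A"
    by (simp add: A_def mult_ac)
  have "Cm * \<rho> * A = C1 * \<rho> * ((C * 4 powr Q) powr (1/p) * A) + P * (C * 4 powr Q) * (2 * \<rho>) * A
      + C1 * (2 * \<rho>) * A"
    by (simp add: Cm_def algebra_simps)
  with 1 2 3 show ?thesis unfolding A_def[symmetric] by linarith
qed

end

section \<open>Interpolation, and the estimates on compact balls\<close>

text \<open>A weighted Young inequality, proved by comparing \<open>X\<close> with
  \<open>\<kappa> * Y\<close>. A small \<open>\<kappa>\<close> makes the coefficient of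
  \<open>Y\<close> small; the large coefficient of \<open>X\<close> is harmless when
  \<open>X\<close> can still be made small afterwards.\<close>

lemma powr_interpolation_le:
  fixes X Y \<kappa> \<theta> :: real
  assumes "0 \<le> X" "0 \<le> Y" "0 < \<kappa>" "0 \<le> \<theta>" "\<theta> \<le> 1"
  shows "X powr (1 - \<theta>) * Y powr \<theta> \<le> \<kappa> powr (- \<theta>) * X + \<kappa> powr (1 - \<theta>) * Y"
proof (cases "X \<le> \<kappa> * Y")
  case True
  have "X powr (1 - \<theta>) * Y powr \<theta> \<le> (\<kappa> * Y) powr (1 - \<theta>) * Y powr \<theta>"
    using True assms by (intro mult_right_mono powr_mono2) auto
  also have "\<dots> = \<kappa> powr (1 - \<theta>) * Y"
    using assms by (simp add: powr_mult mult.assoc powr_add[symmetric])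
  finally show ?thesis using assms by (simp add: add_increasing)
next
  case False
  then have "Y \<le> X / \<kappa>" using assms by (simp add: field_simps)
  then have "X powr (1 - \<theta>) * Y powr \<theta> \<le> X powr (1 - \<theta>) * (X / \<kappa>) powr \<theta>"
    using assms by (intro mult_left_mono powr_mono2) auto
  also have "\<dots> = X powr (1 - \<theta>) * X powr \<theta> * \<kappa> powr (- \<theta>)"
    using assms by (simp add: powr_divide powr_minus_divide)
  also have "\<dots> = \<kappa> powr (- \<theta>) * X"
    using assms by (simp add: powr_add[symmetric])
  finally show ?thesis using assms by (simp add: add_increasing2)
qed

text \<open>The scale is left adjustable so that it can be matched with the radius in the Poincare
  inequality.\<close>

lemma homogeneous_on_compact:
  assumes "metric_measure_space M" "1 \<le> Q" "locally_homogeneous Q M" "compact K"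
  obtains C R where "\<And>R'. 0 < R' \<Longrightarrow> R' \<le> R \<Longrightarrow> homogeneous_on M K Q C R'" "0 < R"
proof -
  obtain R C where RC: "R > 0" "C \<ge> 1" "\<forall>x\<in>K. \<forall>r1 r2. 0 < r1 \<and> r1 \<le> r2 \<and> r2 < R \<longrightarrow>
        measure M (ball x r2) / r2 powr Q \<le> C * (measure M (ball x r1) / r1 powr Q)"
    using assms(3,4) unfolding locally_homogeneous_def by blast
  show thesis
  proof (rule that[of R C])
    fix R' assume "0 < R'" "R' \<le> R"
    then show "homogeneous_on M K Q C R'" using assms(1,2) RC
      by (intro homogeneous_on.intro) auto
  qed (use RC in auto)
qed

text \<open>Disjoint balls of radius \<open>\<delta>\<close> centred in \<open>K\<close> have mass
  at least \<open>c * \<delta> powr Q\<close> each, and the total mass is finite. Hence the sum of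
  \<open>\<delta> powr t\<close> over them is of order \<open>\<delta> powr (t - Q)\<close>, which
  tends to 0.\<close>

lemma (in homogeneous_on) hausdorff_null_above:
  assumes K: "compact K" and t: "Q < t"
  shows "hausdorff_measure t K = 0"
proof -
  have t0: "0 < t" using Q t by simp
  obtain c where c: "0 < c" "\<And>x r. x \<in> K \<Longrightarrow> 0 < r \<Longrightarrow> r \<le> R/2 \<Longrightarrow> c * r powr Q \<le> m x r"
    using lower_mass_bound[OF K] by blast
  \<comment> \<open>\<open>6 * \<delta>\<close> bounds the diameter of a tripled ball. The added 1
    makes \<open>W\<close> positive at once.\<close>
  define W where "W = 6 powr t * (measure M UNIV + 1) / c"
  have W: "0 < W" using c by (simp add: W_def add_nonneg_pos)
  show ?thesis
  proof (unfold hausdorff_measure_eq_0_iff[OF t0], intro allI impI)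
    fix \<epsilon> :: real assume \<epsilon>: "0 < \<epsilon>"
    define \<delta> where "\<delta> = min (R/2) ((\<epsilon> / W) powr (1 / (t - Q)))"
    have \<delta>: "0 < \<delta>" "\<delta> \<le> R/2" using R \<epsilon> W by (auto simp: \<delta>_def)
    have "\<delta> powr (t - Q) \<le> ((\<epsilon> / W) powr (1 / (t - Q))) powr (t - Q)"
      using \<delta> t by (intro powr_mono2) (auto simp: \<delta>_def)
    then have \<delta>W: "\<delta> powr (t - Q) * W \<le> \<epsilon>"
      using t \<epsilon> W by (simp add: powr_powr field_simps)
    have "K \<subseteq> (\<Union>x\<in>K. ball x \<delta>)" using \<delta> by auto
    then obtain D where D: "D \<subseteq> K" "finite D" "K \<subseteq> (\<Union>x\<in>D. ball x \<delta>)"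
      using compactE_image[OF K, of K "\<lambda>x. ball x \<delta>"] by auto
    obtain x where x: "bij_betw x {0..<card D} D" using ex_bij_betw_nat_finite[OF D(2)] by blast
    define I where "I = {0..<card D}"
    have xI: "x ` I = D" using x by (simp add: I_def bij_betw_def)
    obtain S where S: "S \<subseteq> I" "disjoint_family_on (\<lambda>i. ball (x i) \<delta>) S"
      "\<And>i. i \<in> I \<Longrightarrow> \<exists>j\<in>S. ball (x i) \<delta> \<subseteq> ball (x j) (3 * \<delta>)"
      using vitali_covering_countable[of I "\<lambda>_. \<delta>" x] \<delta> by (auto simp: I_def)
    have fS: "finite S" using S(1) by (rule finite_subset) (simp add: I_def)
    define B where "B i = (if i \<in> S then ball (x i) (3 * \<delta>) else {})" for i
    have "K \<subseteq> (\<Union>i. B i)"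
    proof
      fix y assume "y \<in> K"
      then obtain i where i: "i \<in> I" "y \<in> ball (x i) \<delta>" using D(3) xI by blast
      then obtain j where "j \<in> S" "y \<in> ball (x j) (3 * \<delta>)" using S(3)[OF i(1)] by blast
      then have "y \<in> B j" by (simp add: B_def)
      then show "y \<in> (\<Union>i. B i)" by blast
    qed
    moreover have "\<forall>i. bounded (B i)" by (simp add: B_def)
    moreover have "(\<Sum>i. ennreal (diameter (B i) powr t)) \<le> ennreal \<epsilon>"
    proof -
      have "(\<Sum>i. ennreal (diameter (B i) powr t)) = (\<Sum>i\<in>S. ennreal (diameter (B i) powr t))"
        using fS by (intro suminf_finite) (auto simp: B_def)
      also have "\<dots> = ennreal (\<Sum>i\<in>S. diameter (B i) powr t)" by (intro sum_ennreal) auto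
      finally have eq: "(\<Sum>i. ennreal (diameter (B i) powr t)) = ennreal (\<Sum>i\<in>S. diameter (B i) powr t)" .
      have "(\<Sum>i\<in>S. diameter (B i) powr t) \<le> (\<Sum>i\<in>S. 6 powr t * \<delta> powr (t - Q) / c * m (x i) \<delta>)"
      proof (rule sum_mono)
        fix i assume i: "i \<in> S"
        have "diameter (B i) \<le> 6 * \<delta>"
        proof (rule diameter_le_dist)
          fix y z assume "y \<in> B i" "z \<in> B i"
          then show "dist y z \<le> 6 * \<delta>"
            using i dist_triangle[of y z "x i"] by (simp add: B_def dist_commute)
        qed (use \<delta> in auto)
        then have "diameter (B i) powr t \<le> (6 * \<delta>) powr t"
          using t0 by (intro powr_mono2) (auto simp: B_def intro!: diameter_ge_0)
        also have "\<dots> = 6 powr t * \<delta> powr (t - Q) * \<delta> powr Q"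
          using \<delta> by (simp add: powr_mult powr_add[symmetric] mult.assoc)
        also have "\<dots> \<le> 6 powr t * \<delta> powr (t - Q) * (m (x i) \<delta> / c)"
        proof (rule mult_left_mono)
          have "x i \<in> K" using i S(1) xI D(1) by blast
          then show "\<delta> powr Q \<le> m (x i) \<delta> / c" using c \<delta> by (simp add: field_simps)
        qed auto
        finally show "diameter (B i) powr t \<le> 6 powr t * \<delta> powr (t - Q) / c * m (x i) \<delta>" by simp
      qed
      also have "\<dots> = 6 powr t * \<delta> powr (t - Q) / c * measure M (\<Union>i\<in>S. ball (x i) \<delta>)"
        using fS S(2) by (subst finite_measure_finite_Union) (auto simp: sets_M sum_distrib_left)
      also have "\<dots> \<le> 6 powr t * \<delta> powr (t - Q) / c * (measure M UNIV + 1)"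
        using c finite_measure_mono[of "\<Union>i\<in>S. ball (x i) \<delta>" UNIV]
        by (intro mult_left_mono) (auto simp: sets_M)
      also have "\<dots> = \<delta> powr (t - Q) * W" by (simp add: W_def)
      also have "\<dots> \<le> \<epsilon>" by (rule \<delta>W)
      finally show ?thesis unfolding eq by (rule ennreal_leI)
    qed
    ultimately show "\<exists>C::nat \<Rightarrow> 'a set. K \<subseteq> (\<Union>i. C i) \<and> (\<forall>i. bounded (C i)) \<and>
       (\<Sum>i. ennreal (diameter (C i) powr t)) \<le> ennreal \<epsilon>" by blast
  qed
qed

lemma UNIV_eq_UN_cball: "(UNIV :: 'a::metric_space set) = (\<Union>n. cball x0 (real n))"
  using real_arch_simple by (auto simp: set_eq_iff)

text \<open>This makes the dimension of every subset finite, so that \<open>real_of_ereal\<close> in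
  the dimension bound never takes its default value.\<close>

lemma hausdorff_null_above_homogeneous_dimension:
  fixes M :: "'a::metric_space measure"
  assumes "metric_measure_space M" "1 \<le> Q" "locally_homogeneous Q M" "proper_space TYPE('a)" "Q < t"
  shows "hausdorff_measure t (E :: 'a set) = 0"
proof -
  fix x0 :: 'a
  have cpt: "compact (cball x0 (real n))" for n using assms(4) by (simp add: proper_space_def)
  have t: "0 < t" using assms by simp
  have "hausdorff_measure t (cball x0 (real n)) = 0" for n
  proof -
    obtain C R where "\<And>R'. 0 < R' \<Longrightarrow> R' \<le> R \<Longrightarrow> homogeneous_on M (cball x0 (real n)) Q C R'" "0 < R"
      using homogeneous_on_compact[OF assms(1-3) cpt] by blast
    then have "homogeneous_on M (cball x0 (real n)) Q C R" by simp
    then show ?thesis using homogeneous_on.hausdorff_null_above cpt assms(5) by blast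
  qed
  then have "hausdorff_measure t (\<Union>n. cball x0 (real n)) = 0" by (rule hausdorff_null_UN[OF t])
  then show ?thesis by (rule hausdorff_null_mono[OF t]) (use UNIV_eq_UN_cball in auto)
qed

lemma local_morrey_estimate:
  fixes M :: "'a::metric_space measure" and f :: "'a \<Rightarrow> 'b::metric_space"
  assumes Q: "1 \<le> Q" "Q < p" and mms: "metric_measure_space M" and proper: "proper_space TYPE('a)"
    and hom: "locally_homogeneous Q M"
    and poincare: "local_poincare Q M" and f: "continuous_on UNIV f"
    and g: "upper_gradient f g" "Lp_loc p M g"
  fixes x0 :: 'a and n :: real
  obtains N C R \<sigma> D where "homogeneous_on M (cball x0 (n + 1)) Q C R" "finite_measure N" "sets N = sets M"
    "1 \<le> \<sigma>" "0 \<le> D"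
    "\<And>x y \<rho>. x \<in> cball x0 n \<Longrightarrow> y \<in> ball x \<rho> \<Longrightarrow> \<rho> \<le> 1 \<Longrightarrow> 4 * (\<sigma> * \<rho>) < R \<Longrightarrow>
      dist (f y) (f x) \<le>
        D * \<rho> * (measure N (ball x (2 * (\<sigma> * \<rho>))) / measure M (ball x (2 * (\<sigma> * \<rho>)))) powr (1 / p)"
proof -
  let ?K = "cball x0 (n + 1)"
  have cpt: "compact (cball x r)" for x :: 'a and r using proper by (simp add: proper_space_def)
  obtain C R1 where H: "\<And>R'. 0 < R' \<Longrightarrow> R' \<le> R1 \<Longrightarrow> homogeneous_on M ?K Q C R'" and R1: "0 < R1"
    using homogeneous_on_compact[OF mms Q(1) hom cpt] by blast
  obtain N P \<sigma> R2 where N: "finite_measure N" "sets N = sets M" and P: "1 \<le> P" and \<sigma>: "1 \<le> \<sigma>" and R2: "0 < R2"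
    and poin: "\<And>z x r. x \<in> ?K \<Longrightarrow> 0 < r \<Longrightarrow> r < R2 \<Longrightarrow>
      (LINT y:ball x r|M. \<bar>dist (f y) z - (LINT y:ball x r|M. dist (f y) z) / measure M (ball x r)\<bar>)
      \<le> P * r * measure M (ball x r) *
         (measure N (ball x (\<sigma> * r)) / measure M (ball x (\<sigma> * r))) powr (1 / p)"
    by (rule poincare_power_mean[OF Q mms proper poincare f g, of x0 "n + 1"]) blast
  define R where "R = min R1 R2"
  have hR: "homogeneous_on M ?K Q C R" using R1 R2 by (intro H) (auto simp: R_def)
  interpret H: homogeneous_on M ?K Q C R by (rule hR)
  have mor: "morrey M ?K Q C R N (\<lambda>y. dist (f y) z) p P \<sigma>" for z
  proof (intro morrey.intro morrey_axioms.intro hR N Q P \<sigma>)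
    show u: "continuous_on UNIV (\<lambda>y. dist (f y) z)" using f by (intro continuous_intros)
    show "set_integrable M (ball x r) (\<lambda>y. dist (f y) z)" for x r
      by (rule set_integrable_ball_continuous[OF H.finite_measure_axioms H.sets_M cpt u])
  qed (use poin Q in \<open>auto simp: R_def\<close>)
  define D where "D = morrey.Cm Q C p P"
  show thesis
  proof (rule that[OF hR N \<sigma>, of D])
    show "0 \<le> D" unfolding D_def by (rule morrey.Cm_nonneg[OF mor])
    fix x y \<rho> assume xy: "x \<in> cball x0 n" "y \<in> ball x \<rho>" and \<rho>: "\<rho> \<le> 1" "4 * (\<sigma> * \<rho>) < R"
    \<comment> \<open>The margin 1 in \<open>?K\<close> is spent here: \<open>y\<close>, too, must
      lie where the estimates hold.\<close>
    have "x \<in> ?K" "y \<in> ?K" using xy \<rho> dist_triangle[of x0 y x] by auto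
    \<comment> \<open>The choice \<open>z = f x\<close> turns the oscillation of the real function
      into the distance of the images.\<close>
    then have "\<bar>dist (f y) (f x) - dist (f x) (f x)\<bar> \<le>
        D * \<rho> * morrey.mean_density M N p x (2 * (\<sigma> * \<rho>))"
      unfolding D_def using xy \<rho> by (intro morrey.morrey_estimate[OF mor]) auto
    then show "dist (f y) (f x) \<le>
        D * \<rho> * (measure N (ball x (2 * (\<sigma> * \<rho>))) / measure M (ball x (2 * (\<sigma> * \<rho>)))) powr (1 / p)"
      by (simp add: morrey.mean_density_def[OF mor])
  qed
qed

section \<open>Images of null sets\<close>

text \<open>Boundedness of \<open>A\<close> supplies uniform constants. The order of choices is
  essential: \<open>L\<close> depends only on the region, then \<open>\<kappa>\<close> makes the
  bounded sum small, and only then \<open>\<eta>\<close> makes the cover fine enough for the other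
  sum.\<close>

lemma hausdorff_null_image_local:
  fixes M :: "'a::metric_space measure" and f :: "'a \<Rightarrow> 'b::metric_space"
  assumes Q: "1 \<le> Q" "Q < q" "q < p" and mms: "metric_measure_space M" and proper: "proper_space TYPE('a)"
    and hom: "locally_homogeneous Q M"
    and poincare: "local_poincare Q M" and f: "continuous_on UNIV f"
    and g: "upper_gradient f g" "Lp_loc p M g"
    and t: "0 < t" and A: "hausdorff_measure t A = 0" "A \<subseteq> cball x0 n"
  shows "hausdorff_measure (q * t / (q - Q + t)) (f ` A) = 0"
proof (cases "A = {}")
  case True
  then show ?thesis using Q t by (simp add: hausdorff_measure_empty)
next
  case False
  have Qp: "Q < p" using Q by simp
  obtain N C R \<sigma> D where hR: "homogeneous_on M (cball x0 (n + 1)) Q C R" and N: "finite_measure N" "sets N = sets M"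
    and \<sigma>: "1 \<le> \<sigma>" and D: "0 \<le> D" and
    mor: "\<And>x y \<rho>. x \<in> cball x0 n \<Longrightarrow> y \<in> ball x \<rho> \<Longrightarrow> \<rho> \<le> 1 \<Longrightarrow> 4 * (\<sigma> * \<rho>) < R \<Longrightarrow>
      dist (f y) (f x) \<le>
        D * \<rho> * (measure N (ball x (2 * (\<sigma> * \<rho>))) / measure M (ball x (2 * (\<sigma> * \<rho>)))) powr (1 / p)"
    by (rule local_morrey_estimate[OF Q(1) Qp mms proper hom poincare f g, of x0 n]) blast
  interpret H: homogeneous_on M "cball x0 (n + 1)" Q C R by (rule hR)
  have cpt: "compact (cball x0 (n + 1))" using proper by (simp add: proper_space_def)
  obtain c where c: "0 < c" "\<And>x r. x \<in> cball x0 (n + 1) \<Longrightarrow> 0 < r \<Longrightarrow> r \<le> R/2 \<Longrightarrow> c * r powr Q \<le> H.m x r"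
    using H.lower_mass_bound[OF cpt] by blast
  \<comment> \<open>The Morrey estimate on the tripled ball uses the mean over radius
    \<open>2 * (\<sigma> * (3 * r))\<close>.\<close>
  define \<Lambda> where "\<Lambda> = 6 * \<sigma>"
  have \<Lambda>: "1 \<le> \<Lambda>" using \<sigma> by (simp add: \<Lambda>_def)
  have qp: "0 \<le> q/p" "q/p < 1" using Q by auto
  obtain L where L: "0 \<le> L" and Lsum: "\<And>(x :: nat \<Rightarrow> 'a) r F. finite F \<Longrightarrow> (\<And>i. i \<in> F \<Longrightarrow> x i \<in> cball x0 (n + 1)) \<Longrightarrow>
    (\<And>i. i \<in> F \<Longrightarrow> 0 < r i) \<Longrightarrow> (\<And>i. i \<in> F \<Longrightarrow> 3 * (\<Lambda> * r i) < R) \<Longrightarrow>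
    disjoint_family_on (\<lambda>i. ball (x i) (r i)) F \<Longrightarrow>
    (\<Sum>i\<in>F. H.m (x i) (r i) *
      (measure N (ball (x i) (\<Lambda> * r i)) / H.m (x i) (\<Lambda> * r i)) powr (q/p)) \<le> L"
    by (rule H.averaged_powr_sum_bounded[OF N \<Lambda> qp]) blast
  \<comment> \<open>\<open>\<theta>\<close> solves
    \<open>t * (1 - \<theta>) + Q * \<theta> = q * \<theta>\<close>. With it,
    \<open>r powr \<alpha> * a powr (\<alpha>/p)\<close> splits into the
    \<open>(1 - \<theta>)\<close>-th power of \<open>r powr t\<close> and the
    \<open>\<theta>\<close>-th power of \<open>r powr Q * a powr (q/p)\<close>.\<close>
  define \<theta> where "\<theta> = t / (q - Q + t)"
  have \<theta>: "0 < \<theta>" "\<theta> < 1" using Q t by (auto simp: \<theta>_def field_simps)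
  define \<alpha> where "\<alpha> = q * \<theta>"
  have \<alpha>: "0 < \<alpha>" using Q \<theta> by (simp add: \<alpha>_def)
  have exponent: "t * (1 - \<theta>) + Q * \<theta> = \<alpha>"
  proof -
    have "\<theta> * (q - Q + t) = t" using Q t by (simp add: \<theta>_def)
    then show ?thesis unfolding \<alpha>_def by (simp add: algebra_simps)
  qed
  \<comment> \<open>\<open>D\<close> may vanish; the added 1 keeps \<open>W\<close> available as a
    divisor.\<close>
  define W where "W = (6 * D) powr \<alpha> + 1"
  have W: "0 < W" "(6 * D) powr \<alpha> \<le> W" by (auto simp: W_def add_nonneg_pos)
  \<comment> \<open>The estimates below ask for \<open>3 * r \<le> 1\<close> and for
    \<open>12 * \<sigma> * r\<close> and \<open>18 * \<sigma> * r\<close> to be below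
    \<open>R\<close>; the factor 20 covers both of the latter.\<close>
  define r0 where "r0 = min (1/3) (R / (20 * \<sigma>))"
  have r0: "0 < r0" using H.R \<sigma> by (simp add: r0_def)
  have small: "3 * r \<le> 1" "4 * (\<sigma> * (3 * r)) < R" "3 * (\<Lambda> * r) < R" "r \<le> R/2" if "0 < r" "r \<le> r0" for r
  proof -
    have "r \<le> R / (20 * \<sigma>)" "r \<le> 1/3" using that by (auto simp: r0_def)
    then have 1: "20 * (\<sigma> * r) \<le> R" using \<sigma> by (simp add: field_simps)
    have 2: "0 < \<sigma> * r" "r \<le> \<sigma> * r" using that \<sigma> by auto
    show "3 * r \<le> 1" "4 * (\<sigma> * (3 * r)) < R" "3 * (\<Lambda> * r) < R" "r \<le> R/2"
      using 1 2 \<open>r \<le> 1/3\<close> unfolding \<Lambda>_def by linarith+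
  qed
  have "hausdorff_measure \<alpha> (f ` A) = 0"
  proof (unfold hausdorff_measure_eq_0_iff[OF \<alpha>], intro allI impI)
    fix \<epsilon> :: real assume \<epsilon>: "0 < \<epsilon>"
    \<comment> \<open>Chosen so that \<open>\<kappa> powr (1 - \<theta>) = \<beta>\<close> gives the
      bounded sum a share of at most \<open>\<epsilon>/2\<close>. \<open>L + 1\<close> avoids
      division by zero.\<close>
    define \<beta> where "\<beta> = \<epsilon> * c / (2 * W * (L + 1))"
    have \<beta>: "0 < \<beta>" unfolding \<beta>_def using \<epsilon> c W L by (intro divide_pos_pos mult_pos_pos) auto
    define \<kappa> where "\<kappa> = \<beta> powr (1 / (1 - \<theta>))"
    have \<kappa>: "0 < \<kappa>" using \<beta> by (simp add: \<kappa>_def)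
    have \<kappa>1: "\<kappa> powr (1 - \<theta>) = \<epsilon> * c / (2 * W * (L + 1))"
      using \<theta> \<beta> by (simp add: \<kappa>_def powr_powr \<beta>_def[symmetric])
    \<comment> \<open>The first bound forces every radius below \<open>r0\<close>; the second gives
      the sum of \<open>r i powr t\<close> its share \<open>\<epsilon>/2\<close>.\<close>
    define \<eta> where "\<eta> = min (r0 powr t) (\<epsilon> * \<kappa> powr \<theta> / (2 * W))"
    have \<eta>: "0 < \<eta>" using r0 \<epsilon> \<kappa> W by (simp add: \<eta>_def)
    obtain x r where xA: "\<And>i. x i \<in> A" and r: "\<And>i. 0 < r i" and cov: "A \<subseteq> (\<Union>i. ball (x i) (r i))"
      and sm: "summable (\<lambda>i. r i powr t)" and rsum: "(\<Sum>i. r i powr t) \<le> \<eta>"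
      using hausdorff_null_ball_cover[OF t A(1) False \<eta>] by blast
    have rsum': "(\<Sum>i\<in>F. r i powr t) \<le> \<eta>" if "finite F" for F
      using sum_le_suminf[OF sm that] rsum by simp
    have rr0: "r i \<le> r0" for i
    proof (rule powr_le_cancel2[OF t])
      show "r i powr t \<le> r0 powr t" using rsum'[of "{i}"] by (simp add: \<eta>_def)
    qed (use r0 in simp)
    note sml = small[OF r rr0]
    \<comment> \<open>Summability of \<open>r i powr t\<close> drives the radii to 0, which is the
      finiteness that the greedy selection requires.\<close>
    have "finite {i \<in> UNIV. b \<le> r i}" if b: "0 < b" for b
    proof -
      have "\<forall>\<^sub>F i in sequentially. r i powr t < b powr t"
        using order_tendstoD(2)[OF summable_LIMSEQ_zero[OF sm], of "b powr t"] b by simp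
      then obtain k where k: "\<And>i. k \<le> i \<Longrightarrow> r i powr t < b powr t"
        unfolding eventually_sequentially by blast
      have "i < k" if "b \<le> r i" for i
      proof (rule ccontr)
        assume "\<not> i < k"
        then have "r i powr t < b powr t" using k by simp
        moreover have "b powr t \<le> r i powr t" using that b t by (intro powr_mono2) auto
        ultimately show False by simp
      qed
      then have "{i \<in> UNIV. b \<le> r i} \<subseteq> {..<k}" by auto
      then show ?thesis by (rule finite_subset) simp
    qed
    then obtain S where disj: "disjoint_family_on (\<lambda>i. ball (x i) (r i)) S"
      and Scov: "\<And>i. \<exists>j\<in>S. ball (x i) (r i) \<subseteq> ball (x j) (3 * r j)"
      using vitali_covering_countable[of UNIV r x] r by auto
    define a where "a i = measure N (ball (x i) (\<Lambda> * r i)) / H.m (x i) (\<Lambda> * r i)" for i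
    have a0: "0 \<le> a i" for i by (simp add: a_def)
    define B where "B i = (if i \<in> S then f ` ball (x i) (3 * r i) else {})" for i
    have dist_f: "dist (f y) (f (x i)) \<le> 3 * D * r i * a i powr (1/p)" if "y \<in> ball (x i) (3 * r i)" for y i
    proof -
      have "x i \<in> cball x0 n" using xA A(2) by blast
      then have "dist (f y) (f (x i)) \<le> D * (3 * r i) * (measure N (ball (x i) (2 * (\<sigma> * (3 * r i)))) /
          H.m (x i) (2 * (\<sigma> * (3 * r i)))) powr (1 / p)"
        using sml by (intro mor that)
      also have "2 * (\<sigma> * (3 * r i)) = \<Lambda> * r i" by (simp add: \<Lambda>_def)
      finally show ?thesis by (simp add: a_def mult_ac)
    qed
    have bB: "bounded (B i)" for i
    proof -
      have "\<forall>y\<in>B i. dist (f (x i)) y \<le> 3 * D * r i * a i powr (1/p)"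
        using dist_f[of _ i] by (auto simp: B_def dist_commute)
      then show ?thesis unfolding bounded_def by blast
    qed
    have dB: "diameter (B i) \<le> 6 * D * r i * a i powr (1/p)" for i
    proof (rule diameter_le_dist)
      fix y z assume "y \<in> B i" "z \<in> B i"
      then have "dist y (f (x i)) \<le> 3 * D * r i * a i powr (1/p)" "dist z (f (x i)) \<le> 3 * D * r i * a i powr (1/p)"
        using dist_f[of _ i] by (auto simp: B_def split: if_splits)
      then show "dist y z \<le> 6 * D * r i * a i powr (1/p)"
        using dist_triangle2[of y z "f (x i)"] by linarith
    qed (use D r[of i] in auto)
    have term_bound: "diameter (B i) powr \<alpha> \<le> W * \<kappa> powr (- \<theta>) * r i powr t
        + W * \<kappa> powr (1 - \<theta>) / c * (H.m (x i) (r i) * a i powr (q/p))" for i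
    proof -
      have "diameter (B i) powr \<alpha> \<le> (6 * D * r i * a i powr (1/p)) powr \<alpha>"
        using \<alpha> dB bB by (intro powr_mono2 diameter_ge_0) auto
      also have "\<dots> = (6 * D) powr \<alpha> * (r i powr \<alpha> * a i powr (\<alpha>/p))"
        using D r[of i] by (simp add: powr_mult powr_powr)
      also have "r i powr \<alpha> * a i powr (\<alpha>/p) = (r i powr t) powr (1 - \<theta>) * (r i powr Q * a i powr (q/p)) powr \<theta>"
      proof -
        have "r i powr \<alpha> = r i powr (t * (1 - \<theta>)) * r i powr (Q * \<theta>)"
          by (simp add: powr_add[symmetric] exponent)
        then show ?thesis by (simp add: powr_mult powr_powr mult_ac \<alpha>_def)
      qed
      also have "(6 * D) powr \<alpha> * \<dots> \<le> W * (\<kappa> powr (- \<theta>) * r i powr t + \<kappa> powr (1 - \<theta>) * (r i powr Q * a i powr (q/p)))"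
        using W \<kappa> \<theta> by (intro mult_mono powr_interpolation_le) auto
      also have "\<dots> \<le> W * (\<kappa> powr (- \<theta>) * r i powr t + \<kappa> powr (1 - \<theta>) * (H.m (x i) (r i) / c * a i powr (q/p)))"
      proof (intro mult_left_mono add_left_mono mult_right_mono)
        have "x i \<in> cball x0 (n + 1)" using xA[of i] A(2) by auto
        then show "r i powr Q \<le> H.m (x i) (r i) / c" using c(2)[of "x i" "r i"] c(1) r[of i] sml(4)[of i]
          by (simp add: field_simps)
      qed (use W in auto)
      finally show ?thesis by (simp add: algebra_simps)
    qed
    \<comment> \<open>Partial sums suffice, and they involve only finitely many balls, as
      \<open>Lsum\<close> demands.\<close>
    have "(\<Sum>i<k. ennreal (diameter (B i) powr \<alpha>)) \<le> ennreal \<epsilon>" for k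
    proof -
      define F where "F = S \<inter> {..<k}"
      have fF: "finite F" by (simp add: F_def)
      have "(\<Sum>i<k. diameter (B i) powr \<alpha>) = (\<Sum>i\<in>F. diameter (B i) powr \<alpha>)"
        by (rule sum.mono_neutral_right) (auto simp: F_def B_def)
      also have "\<dots> \<le> (\<Sum>i\<in>F. W * \<kappa> powr (- \<theta>) * r i powr t
          + W * \<kappa> powr (1 - \<theta>) / c * (H.m (x i) (r i) * a i powr (q/p)))"
        by (intro sum_mono term_bound)
      also have "\<dots> = W * \<kappa> powr (- \<theta>) * (\<Sum>i\<in>F. r i powr t)
          + W * \<kappa> powr (1 - \<theta>) / c * (\<Sum>i\<in>F. H.m (x i) (r i) * a i powr (q/p))"
        by (simp add: sum.distrib sum_distrib_left)
      also have "\<dots> \<le> W * \<kappa> powr (- \<theta>) * \<eta> + W * \<kappa> powr (1 - \<theta>) / c * L"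
      proof (intro add_mono mult_left_mono rsum'[OF fF])
        show "(\<Sum>i\<in>F. H.m (x i) (r i) * a i powr (q/p)) \<le> L" unfolding a_def
        proof (rule Lsum[OF fF])
          show "disjoint_family_on (\<lambda>i. ball (x i) (r i)) F"
            using disj by (rule disjoint_family_on_mono[rotated]) (auto simp: F_def)
          fix i assume "i \<in> F"
          show "x i \<in> cball x0 (n + 1)" using xA[of i] A(2) by auto
        qed (use r sml in auto)
      qed (use W c in auto)
      also have "\<dots> \<le> \<epsilon>/2 + \<epsilon>/2"
      proof (rule add_mono)
        have "W * \<kappa> powr (- \<theta>) * \<eta> \<le> W * \<kappa> powr (- \<theta>) * (\<epsilon> * \<kappa> powr \<theta> / (2 * W))"
          using W by (intro mult_left_mono) (auto simp: \<eta>_def)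
        also have "\<dots> = \<epsilon>/2" using W \<kappa> by (simp add: powr_minus field_simps)
        finally show "W * \<kappa> powr (- \<theta>) * \<eta> \<le> \<epsilon>/2" .
        have "W * \<kappa> powr (1 - \<theta>) / c * L = \<epsilon>/2 * (L / (L + 1))"
          unfolding \<kappa>1 using W(1) c(1) by simp
        also have "\<dots> \<le> \<epsilon>/2 * 1" using \<epsilon> L by (intro mult_left_mono) auto
        finally show "W * \<kappa> powr (1 - \<theta>) / c * L \<le> \<epsilon>/2" by simp
      qed
      finally have "(\<Sum>i<k. diameter (B i) powr \<alpha>) \<le> \<epsilon>" by simp
      then have "ennreal (\<Sum>i<k. diameter (B i) powr \<alpha>) \<le> ennreal \<epsilon>" by (rule ennreal_leI)
      then show ?thesis by (subst sum_ennreal) auto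
    qed
    then have "(\<Sum>i. ennreal (diameter (B i) powr \<alpha>)) \<le> ennreal \<epsilon>"
      unfolding suminf_eq_SUP by (intro SUP_least)
    moreover have "f ` A \<subseteq> (\<Union>i. B i)"
    proof
      fix y assume "y \<in> f ` A"
      then obtain w i where w: "y = f w" "w \<in> ball (x i) (r i)" using cov by blast
      then obtain j where "j \<in> S" "w \<in> ball (x j) (3 * r j)" using Scov[of i] by blast
      then have "y \<in> B j" using w(1) by (simp add: B_def)
      then show "y \<in> (\<Union>i. B i)" by blast
    qed
    ultimately show "\<exists>C::nat \<Rightarrow> 'b set. f ` A \<subseteq> (\<Union>i. C i) \<and> (\<forall>i. bounded (C i)) \<and>
       (\<Sum>i. ennreal (diameter (C i) powr \<alpha>)) \<le> ennreal \<epsilon>" using bB by blast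
  qed
  then show ?thesis by (simp add: \<alpha>_def \<theta>_def)
qed

text \<open>The constants of the local version vary with the ball but the exponent does not, so
  countable unions of null sets finish the argument.\<close>

lemma hausdorff_null_image:
  fixes M :: "'a::metric_space measure" and f :: "'a \<Rightarrow> 'b::metric_space"
  assumes Q: "1 \<le> Q" "Q < q" "q < p" and mms: "metric_measure_space M" and proper: "proper_space TYPE('a)"
    and hom: "locally_homogeneous Q M"
    and poincare: "local_poincare Q M" and f: "continuous_on UNIV f"
    and g: "upper_gradient f g" "Lp_loc p M g"
    and t: "0 < t" and E: "hausdorff_measure t E = 0"
  shows "hausdorff_measure (q * t / (q - Q + t)) (f ` E) = 0"
proof -
  fix x0 :: 'a
  let ?A = "\<lambda>n. E \<inter> cball x0 (real n)"
  have "hausdorff_measure (q * t / (q - Q + t)) (f ` ?A n) = 0" for n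
    by (rule hausdorff_null_image_local[OF Q mms proper hom poincare f g t hausdorff_null_mono[OF t E]]) auto
  then have "hausdorff_measure (q * t / (q - Q + t)) (\<Union>n. f ` ?A n) = 0"
    using Q t by (intro hausdorff_null_UN) auto
  also have "(\<Union>n. f ` ?A n) = f ` E"
    using UNIV_eq_UN_cball[of x0] by blast
  finally show ?thesis .
qed

section \<open>Hausdorff dimension and the passage to the limit\<close>

lemma hausdorff_dim_le:
  assumes "0 \<le> t" "hausdorff_measure t A = 0"
  shows "hausdorff_dim A \<le> ereal t"
  unfolding hausdorff_dim_def using assms by (intro Inf_lower) auto

lemma hausdorff_dim_nonneg: "0 \<le> hausdorff_dim A"
  unfolding hausdorff_dim_def by (intro Inf_greatest) auto

lemma hausdorff_null_above_dim:
  assumes "hausdorff_dim A < ereal t"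
  shows "hausdorff_measure t A = 0"
proof -
  obtain s where "0 \<le> s" "hausdorff_measure s A = 0" "s < t"
    using assms unfolding hausdorff_dim_def Inf_less_iff by auto
  then show ?thesis using hausdorff_null_mono_exponent by blast
qed

theorem theorem1p1:
  fixes M :: "'a::metric_space measure"
    and f :: "'a \<Rightarrow> 'b::metric_space"
    and Q p :: real
  assumes "1 \<le> Q"
    and "metric_measure_space M"
    and "proper_space TYPE('a)"
    and "locally_homogeneous Q M"
    and "local_poincare Q M"
    and "Q < p"
    and "continuous_on UNIV f"
    and "\<exists>g. upper_gradient f g \<and> Lp_loc p M g"
  shows "\<forall>E :: 'a set.
           hausdorff_dim (f ` E)
             \<le> ereal (p * real_of_ereal (hausdorff_dim E)
                       / (p - Q + real_of_ereal (hausdorff_dim E)))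
         \<and> (hausdorff_measure Q E = 0 \<longrightarrow> hausdorff_measure Q (f ` E) = 0)"
proof (intro allI conjI impI)
  fix E :: "'a set"
  obtain g where g: "upper_gradient f g" "Lp_loc p M g" using assms(8) by blast
  note null = hausdorff_null_image[OF assms(1) _ _ assms(2-5,7) g]
  {
    assume E: "hausdorff_measure Q E = 0"
    \<comment> \<open>Any intermediate \<open>q\<close> will do: for \<open>t = Q\<close> the image
      exponent \<open>q * Q / (q - Q + Q)\<close> is \<open>Q\<close> itself.\<close>
    obtain q where q: "Q < q" "q < p" using dense[OF assms(6)] by blast
    have "hausdorff_measure (q * Q / (q - Q + Q)) (f ` E) = 0"
      using assms(1) E by (intro null q) auto
    then show "hausdorff_measure Q (f ` E) = 0" using assms(1) q by simp
  }
  define D where "D = real_of_ereal (hausdorff_dim E)"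
  have "hausdorff_dim E \<le> ereal (Q + 1)"
    using assms hausdorff_null_above_homogeneous_dimension[of M Q "Q + 1" E]
    by (intro hausdorff_dim_le) auto
  then have D: "hausdorff_dim E = ereal D" "0 \<le> D"
    unfolding D_def using hausdorff_dim_nonneg[of E] by (cases "hausdorff_dim E"; simp)+
  \<comment> \<open>Here \<open>q = p - h\<close> and \<open>t = D + h\<close>. Using the same
    \<open>h\<close> twice leaves the denominator constant; \<open>t\<close> is positive even when
    \<open>D = 0\<close>, and \<open>h < p - Q\<close> keeps \<open>q\<close> above
    \<open>Q\<close>.\<close>
  have bound: "hausdorff_dim (f ` E) \<le> ereal ((p - h) * (D + h) / (p - Q + D))" if h: "0 < h" "h < p - Q" for h
  proof -
    have "hausdorff_measure (D + h) E = 0" using h by (intro hausdorff_null_above_dim) (simp add: D)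
    then have "hausdorff_measure ((p - h) * (D + h) / (p - h - Q + (D + h))) (f ` E) = 0"
      using h D by (intro null) auto
    moreover have "p - h - Q + (D + h) = p - Q + D" by simp
    ultimately show ?thesis using h D assms(1) by (intro hausdorff_dim_le) auto
  qed
  have "((\<lambda>h. (p - h) * (D + h) / (p - Q + D)) \<longlongrightarrow> (p - 0) * (D + 0) / (p - Q + D)) (at_right 0)"
    using assms(6) D(2) by (intro tendsto_intros) auto
  then have "((\<lambda>h. ereal ((p - h) * (D + h) / (p - Q + D))) \<longlongrightarrow> ereal (p * D / (p - Q + D))) (at_right 0)"
    by (simp add: tendsto_ereal)
  moreover have "\<forall>\<^sub>F h in at_right 0. hausdorff_dim (f ` E) \<le> ereal ((p - h) * (D + h) / (p - Q + D))"
    using bound assms(6) by (intro eventually_at_rightI[of 0 "p - Q"]) auto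
  ultimately show "hausdorff_dim (f ` E) \<le> ereal (p * D / (p - Q + D))"
    by (rule tendsto_lowerbound) simp
qed

end
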